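(* Let $A_S$ be a parabolic-retractable Artin group (associated to a Coxeter matrix over a finite set $S$) and let $X\subseteq S$. Then there exists an ordinary retraction $\varphi:A_S\to A_X$.
   Context: A Coxeter matrix over a finite set $S$ is a matrix $M=(m_{s,t})_{s,t\in S}$ with entries in $\mathbb{N}\cup\{\infty\}$, $m_{s,s}=1$, and $m_{s,t}=m_{t,s}\ge 2$ for $s\neq t$. Write $\Pi(s,t,m)$ for the alternating word $sts\cdots$ of length $m$. The Artin group of $M$ is $A_S=\langle S\mid \Pi(s,t,m_{s,t})=\Pi(t,s,m_{s,t})$ for $s\neq t$, $m_{s,t}\neq\infty\rangle$. For $X\subseteq S$, $A_X$ is the subgroup generated by $X$. A retraction of $G$ onto a subgroup $H$ is a homomorphism $\varphi:G\to H$ with $\varphi|_H=\mathrm{id}_H$. $A_S$ is parabolic-retractable if it admits a retraction onto $A_X$ for every $X\subseteq S$. A retraction $\varphi:A_S\to A_X$ is ordinary if $\varphi(x)=x$ for every $x\in X$ and $\varphi(y)\in X\cup\{1\}$ for every $y\in S\setminus X$. *)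

theory Defs
  imports "HOL-Algebra.Algebra" "HOL-Library.Extended_Nat"
begin

definition coxeter_matrix :: "('s \<Rightarrow> 's \<Rightarrow> enat) \<Rightarrow> 's set \<Rightarrow> bool" where
  "coxeter_matrix M S \<longleftrightarrow> finite S \<and> (\<forall>s\<in>S. M s s = 1) \<and>
     (\<forall>s\<in>S. \<forall>t\<in>S. s \<noteq> t \<longrightarrow> M s t = M t s \<and> M s t \<ge> 2)"

text \<open>Letters: (s, False) stands for s, (s, True) for the inverse of s.\<close>
type_synonym 's aword = "('s \<times> bool) list"

fun alt_word :: "'s \<Rightarrow> 's \<Rightarrow> nat \<Rightarrow> 's aword" where
  "alt_word s t 0 = []"
| "alt_word s t (Suc n) = (s, False) # alt_word t s n"

definition words_over :: "'s set \<Rightarrow> 's aword set" where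
  "words_over S = {w. set w \<subseteq> S \<times> UNIV}"

inductive artin_eq :: "('s \<Rightarrow> 's \<Rightarrow> enat) \<Rightarrow> 's set \<Rightarrow> 's aword \<Rightarrow> 's aword \<Rightarrow> bool"
  for M S where
  refl: "w \<in> words_over S \<Longrightarrow> artin_eq M S w w"
| sym: "artin_eq M S u v \<Longrightarrow> artin_eq M S v u"
| trans: "artin_eq M S u v \<Longrightarrow> artin_eq M S v w \<Longrightarrow> artin_eq M S u w"
| cancel: "x \<in> words_over S \<Longrightarrow> y \<in> words_over S \<Longrightarrow> s \<in> S \<Longrightarrow>
      artin_eq M S (x @ [(s, b), (s, \<not> b)] @ y) (x @ y)"
| braid: "x \<in> words_over S \<Longrightarrow> y \<in> words_over S \<Longrightarrow> s \<in> S \<Longrightarrow> t \<in> S \<Longrightarrow> s \<noteq> t \<Longrightarrow>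
      M s t = enat m \<Longrightarrow>
      artin_eq M S (x @ alt_word s t m @ y) (x @ alt_word t s m @ y)"

definition artin_class :: "('s \<Rightarrow> 's \<Rightarrow> enat) \<Rightarrow> 's set \<Rightarrow> 's aword \<Rightarrow> 's aword set" where
  "artin_class M S w = {v. artin_eq M S w v}"

definition artin_group :: "('s \<Rightarrow> 's \<Rightarrow> enat) \<Rightarrow> 's set \<Rightarrow> 's aword set monoid" where
  "artin_group M S =
    \<lparr> carrier = artin_class M S ` words_over S,
      monoid.mult = (\<lambda>A B. {v. \<exists>a\<in>A. \<exists>b\<in>B. artin_eq M S (a @ b) v}),
      one = artin_class M S [] \<rparr>"

definition artin_gen :: "('s \<Rightarrow> 's \<Rightarrow> enat) \<Rightarrow> 's set \<Rightarrow> 's \<Rightarrow> 's aword set" where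
  "artin_gen M S s = artin_class M S [(s, False)]"

definition parabolic :: "('s \<Rightarrow> 's \<Rightarrow> enat) \<Rightarrow> 's set \<Rightarrow> 's set \<Rightarrow> 's aword set set" where
  "parabolic M S Y = generate (artin_group M S) (artin_gen M S ` Y)"

definition is_retraction :: "('a, 'b) monoid_scheme \<Rightarrow> 'a set \<Rightarrow> ('a \<Rightarrow> 'a) \<Rightarrow> bool" where
  "is_retraction G H \<phi> \<longleftrightarrow> \<phi> \<in> hom G (G\<lparr>carrier := H\<rparr>) \<and> (\<forall>h\<in>H. \<phi> h = h)"

definition parabolic_retractable :: "('s \<Rightarrow> 's \<Rightarrow> enat) \<Rightarrow> 's set \<Rightarrow> bool" where
  "parabolic_retractable M S \<longleftrightarrow>
     (\<forall>Y. Y \<subseteq> S \<longrightarrow> (\<exists>\<phi>. is_retraction (artin_group M S) (parabolic M S Y) \<phi>))"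

definition ordinary_retraction ::
    "('s \<Rightarrow> 's \<Rightarrow> enat) \<Rightarrow> 's set \<Rightarrow> 's set \<Rightarrow> ('s aword set \<Rightarrow> 's aword set) \<Rightarrow> bool" where
  "ordinary_retraction M S Y \<phi> \<longleftrightarrow>
     is_retraction (artin_group M S) (parabolic M S Y) \<phi> \<and>
     (\<forall>x\<in>Y. \<phi> (artin_gen M S x) = artin_gen M S x) \<and>
     (\<forall>y\<in>S - Y. \<phi> (artin_gen M S y) \<in> artin_gen M S ` Y \<union> {\<one>\<^bsub>artin_group M S\<^esub>})"

end

theory Submission
  imports Defs
begin

text \<open>
  On the subgroup generated by two generators \<open>a\<close> and \<open>b\<close>, suitable deformed reflection
  representations of the Artin group become triangular on a plane, so a retraction onto that
  subgroup yields a homomorphism from the whole group to triangular \<open>2 \<times> 2\<close> matrices. Choosing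
  the parameters at roots of unity, one reads off that in a parabolic-retractable Artin group
  having an odd label is an equivalence relation, that labels between different classes depend
  only on the classes, and that inside a class the labels form an ultrametric for divisibility.
  Hence a single generator can be eliminated by an ordinary retraction: send it to the nearest
  generator of its class, or to \<open>1\<close> if it is alone in its class. Iterating gives all ordinary
  retractions.
\<close>

section \<open>Words and the group structure\<close>

text \<open>A map sending generators to generators or to 1 respects a braid relation of length m as
  soon as the images are equal, or m is even and one image is 1, or the images have a finite label
  dividing m. So the task is to find divisibilities among labels, and these must be extracted from
  arbitrary homomorphisms, under which a generator c goes to an unknown word in a and b. In
  triangular matrices such a word is described by three numbers. An odd label between c and a forces
  equal diagonals; normalised to (\<rho>, 1), they leave one off-diagonal unknown, which an odd
  relation determines unless the order of -\<rho> divides its length. Equality of words over {a, b}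
  means equality in A_S, so each representation is built on all of A_S: the coefficients away from a
  and b are chosen so that the other relations hold too. Odd relations fix products of coefficients,
  even ones are met by commuting operators apart from one pair in the argument for even labels, and
  infinite labels impose nothing.\<close>

lemma words_over_simps [simp]:
  "[] \<in> words_over S"
  "u @ v \<in> words_over S \<longleftrightarrow> u \<in> words_over S \<and> v \<in> words_over S"
  "(s, b) # w \<in> words_over S \<longleftrightarrow> s \<in> S \<and> w \<in> words_over S"
  by (auto simp: words_over_def)

lemma words_over_mono: "w \<in> words_over Y \<Longrightarrow> Y \<subseteq> S \<Longrightarrow> w \<in> words_over S"
  by (auto simp: words_over_def)

lemma alt_word_in_words_over [simp]:
  "s \<in> S \<Longrightarrow> t \<in> S \<Longrightarrow> alt_word s t m \<in> words_over S"
  by (induction m arbitrary: s t) auto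

lemma artin_eq_words_over:
  "artin_eq M S u v \<Longrightarrow> u \<in> words_over S \<and> v \<in> words_over S"
  by (induction rule: artin_eq.induct) auto

lemma artin_eq_context:
  assumes "artin_eq M S u v" "x \<in> words_over S" "y \<in> words_over S"
  shows "artin_eq M S (x @ u @ y) (x @ v @ y)"
  using assms(1)
proof (induction rule: artin_eq.induct)
  case (refl w)
  then show ?case using assms by (intro artin_eq.refl) simp
next
  case (sym u v)
  then show ?case by (rule_tac artin_eq.sym)
next
  case (trans u v w)
  then show ?case by (meson artin_eq.trans)
next
  case (cancel x' y' s b)
  then show ?case
    using artin_eq.cancel[of "x @ x'" S "y' @ y" s M b] assms by simp
next
  case (braid x' y' s t m)
  then show ?case
    using artin_eq.braid[of "x @ x'" S "y' @ y" s t M m] assms by simp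
qed

lemma artin_eq_append:
  assumes "artin_eq M S u u'" "artin_eq M S v v'"
  shows "artin_eq M S (u @ v) (u' @ v')"
proof -
  have "artin_eq M S (u @ v) (u' @ v)"
    using artin_eq_context[OF assms(1), of "[]" v] artin_eq_words_over[OF assms(2)] by simp
  moreover have "artin_eq M S (u' @ v) (u' @ v')"
    using artin_eq_context[OF assms(2), of u' "[]"] artin_eq_words_over[OF assms(1)] by simp
  ultimately show ?thesis by (rule artin_eq.trans)
qed

definition word_inv :: "'s aword \<Rightarrow> 's aword" where
  "word_inv w = rev (map (\<lambda>(s, b). (s, \<not> b)) w)"

lemma word_inv_simps [simp]:
  "word_inv [] = []"
  "word_inv ((s, b) # w) = word_inv w @ [(s, \<not> b)]"
  "word_inv w \<in> words_over S \<longleftrightarrow> w \<in> words_over S"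
  by (auto simp: word_inv_def words_over_def)

lemma word_inv_word_inv [simp]: "word_inv (word_inv w) = w"
  by (simp add: word_inv_def rev_map[symmetric] comp_def case_prod_beta)

lemma artin_eq_word_inv_right:
  "w \<in> words_over S \<Longrightarrow> artin_eq M S (w @ word_inv w) []"
proof (induction w)
  case Nil
  then show ?case by (simp add: artin_eq.refl)
next
  case (Cons l w)
  obtain s b where l: "l = (s, b)" by (cases l)
  have "artin_eq M S ([l] @ (w @ word_inv w) @ [(s, \<not> b)]) ([l] @ [] @ [(s, \<not> b)])"
    using Cons by (intro artin_eq_context) (auto simp: l)
  moreover have "artin_eq M S ([] @ [(s, b), (s, \<not> b)] @ []) ([] @ [])"
    using Cons by (intro artin_eq.cancel) (auto simp: l)
  ultimately show ?case by (auto simp: l intro: artin_eq.trans)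
qed

lemma artin_eq_word_inv_left:
  "w \<in> words_over S \<Longrightarrow> artin_eq M S (word_inv w @ w) []"
  using artin_eq_word_inv_right[of "word_inv w" S M] by simp

lemma artin_class_eq_iff:
  assumes "u \<in> words_over S"
  shows "artin_class M S u = artin_class M S v \<longleftrightarrow> artin_eq M S u v"
proof
  assume "artin_class M S u = artin_class M S v"
  then have "artin_eq M S v u"
    using artin_eq.refl[OF assms, of M] unfolding artin_class_def by auto
  then show "artin_eq M S u v" by (rule artin_eq.sym)
next
  assume "artin_eq M S u v"
  then show "artin_class M S u = artin_class M S v"
    unfolding artin_class_def by (auto intro: artin_eq.sym artin_eq.trans)
qed

lemma artin_mult:
  assumes "u \<in> words_over S" "v \<in> words_over S"
  shows "artin_class M S u \<otimes>\<^bsub>artin_group M S\<^esub> artin_class M S v = artin_class M S (u @ v)"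
proof -
  have "(\<exists>a\<in>artin_class M S u. \<exists>b\<in>artin_class M S v. artin_eq M S (a @ b) w)
      \<longleftrightarrow> artin_eq M S (u @ v) w" for w
    using assms unfolding artin_class_def
    by (auto intro: artin_eq.refl artin_eq.trans artin_eq_append)
  then show ?thesis by (simp add: artin_group_def artin_class_def)
qed

lemma artin_carrier: "carrier (artin_group M S) = artin_class M S ` words_over S"
  and artin_one: "\<one>\<^bsub>artin_group M S\<^esub> = artin_class M S []"
  by (simp_all add: artin_group_def)

lemma artin_group_is_group: "group (artin_group M S)"
proof (rule groupI)
  fix x assume "x \<in> carrier (artin_group M S)"
  then obtain w where w: "w \<in> words_over S" "x = artin_class M S w"
    by (auto simp: artin_carrier)
  then have "artin_class M S (word_inv w) \<otimes>\<^bsub>artin_group M S\<^esub> x = \<one>\<^bsub>artin_group M S\<^esub>"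
    by (simp add: artin_mult artin_one artin_class_eq_iff artin_eq_word_inv_left)
  then show "\<exists>y\<in>carrier (artin_group M S). y \<otimes>\<^bsub>artin_group M S\<^esub> x = \<one>\<^bsub>artin_group M S\<^esub>"
    using w by (intro bexI[of _ "artin_class M S (word_inv w)"]) (auto simp: artin_carrier)
qed (auto simp: artin_carrier artin_mult artin_one)

lemma artin_inv:
  assumes "w \<in> words_over S"
  shows "inv\<^bsub>artin_group M S\<^esub> (artin_class M S w) = artin_class M S (word_inv w)"
proof (rule group.inv_equality[OF artin_group_is_group])
  show "artin_class M S (word_inv w) \<otimes>\<^bsub>artin_group M S\<^esub> artin_class M S w = \<one>\<^bsub>artin_group M S\<^esub>"
    using assms by (simp add: artin_mult artin_one artin_class_eq_iff artin_eq_word_inv_left)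
qed (use assms in \<open>auto simp: artin_carrier\<close>)

text \<open>Translates the generated subgroup into words. The classes are those of the whole group:
  words over \<open>Y\<close> are compared by all relations over \<open>S\<close>.\<close>

lemma parabolic_eq_classes:
  assumes "Y \<subseteq> S"
  shows "parabolic M S Y = artin_class M S ` words_over Y"
proof
  have over: "w \<in> words_over S" if "w \<in> words_over Y" for w
    using that assms by (rule words_over_mono)
  show "parabolic M S Y \<subseteq> artin_class M S ` words_over Y"
  proof
    fix x assume "x \<in> parabolic M S Y"
    then show "x \<in> artin_class M S ` words_over Y"
      unfolding parabolic_def
    proof (induction rule: generate.induct)
      case one
      then show ?case by (auto simp: artin_one)
    next
      case (incl h)
      then show ?case by (auto simp: artin_gen_def)
    next
      case (inv h)
      then obtain s where "s \<in> Y" "h = artin_class M S [(s, False)]"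
        by (auto simp: artin_gen_def)
      then show ?case using assms by (auto simp: artin_inv)
    next
      case (eng h1 h2)
      then show ?case using over by (auto simp: artin_mult)
    qed
  qed
  have "artin_class M S w \<in> parabolic M S Y" if "w \<in> words_over Y" for w
    using that
  proof (induction w)
    case Nil
    show ?case
      unfolding parabolic_def artin_one[symmetric] by (rule generate.one)
  next
    case (Cons l w)
    obtain s b where l: "l = (s, b)" by (cases l)
    have s: "s \<in> Y" "s \<in> S" using Cons.prems assms by (auto simp: l)
    have "artin_class M S [(s, b)] \<in> parabolic M S Y"
    proof (cases b)
      case True
      have "inv\<^bsub>artin_group M S\<^esub> (artin_gen M S s) \<in> parabolic M S Y"
        unfolding parabolic_def using s by (intro generate.inv) auto
      then show ?thesis using s True by (simp add: artin_gen_def artin_inv)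
    next
      case False
      have "artin_gen M S s \<in> parabolic M S Y"
        unfolding parabolic_def using s by (intro generate.incl) auto
      then show ?thesis using False by (simp add: artin_gen_def)
    qed
    moreover have "artin_class M S w \<in> parabolic M S Y" using Cons by (auto simp: l)
    ultimately have "artin_class M S [(s, b)] \<otimes>\<^bsub>artin_group M S\<^esub> artin_class M S w \<in> parabolic M S Y"
      unfolding parabolic_def by (rule generate.eng)
    then show ?case using s Cons.prems over by (simp add: artin_mult l)
  qed
  then show "artin_class M S ` words_over Y \<subseteq> parabolic M S Y" by blast
qed

section \<open>Substitutions and retractions\<close>

definition word_subst :: "('s \<Rightarrow> 's aword) \<Rightarrow> 's aword \<Rightarrow> 's aword" where
  "word_subst W w = concat (map (\<lambda>(s, b). if b then word_inv (W s) else W s) w)"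

lemma word_subst_simps [simp]:
  "word_subst W [] = []"
  "word_subst W ((s, b) # w) = (if b then word_inv (W s) else W s) @ word_subst W w"
  "word_subst W (u @ v) = word_subst W u @ word_subst W v"
  by (auto simp: word_subst_def)

lemma word_subst_in_words_over:
  "\<forall>s\<in>S. W s \<in> words_over Y \<Longrightarrow> w \<in> words_over S \<Longrightarrow> word_subst W w \<in> words_over Y"
  by (induction w) auto

lemma word_subst_id:
  "\<forall>s\<in>Y. W s = [(s, False)] \<Longrightarrow> w \<in> words_over Y \<Longrightarrow> word_subst W w = w"
  by (induction w) auto

text \<open>Universal property of the presentation, for words: a substitution respects free
  cancellation by the choice of inverses, so only the braid relations remain to be checked.\<close>

lemma artin_eq_word_subst:
  assumes eq: "artin_eq M S u v"
    and W: "\<forall>s\<in>S. W s \<in> words_over S"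
    and rel: "\<And>s t m. s \<in> S \<Longrightarrow> t \<in> S \<Longrightarrow> s \<noteq> t \<Longrightarrow> M s t = enat m \<Longrightarrow>
      artin_eq M S (word_subst W (alt_word s t m)) (word_subst W (alt_word t s m))"
  shows "artin_eq M S (word_subst W u) (word_subst W v)"
  using eq
proof (induction rule: artin_eq.induct)
  case (refl w)
  then show ?case using W by (intro artin_eq.refl word_subst_in_words_over[of S])
next
  case (sym u v)
  then show ?case by (rule_tac artin_eq.sym)
next
  case (trans u v w)
  then show ?case by (meson artin_eq.trans)
next
  case (cancel x y s b)
  have "artin_eq M S (word_subst W [(s, b), (s, \<not> b)]) []"
    using W cancel artin_eq_word_inv_right[of "W s"] artin_eq_word_inv_left[of "W s"] by auto
  then have "artin_eq M S (word_subst W x @ word_subst W [(s, b), (s, \<not> b)] @ word_subst W y)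
      (word_subst W x @ [] @ word_subst W y)"
    using W cancel by (intro artin_eq_context word_subst_in_words_over[of S])
  then show ?case by simp
next
  case (braid x y s t m)
  then show ?case
    using W rel[of s t m] by (simp add: artin_eq_context word_subst_in_words_over[of S])
qed

text \<open>Operators are indexed by words, so the retraction is traded for representatives of the
  images of the generators. Taking the letter itself on \<open>Y\<close> makes generators of
  \<open>Y\<close> fixed literally, not just up to relations.\<close>

lemma retraction_word_subst:
  assumes ret: "is_retraction (artin_group M S) (parabolic M S Y) \<phi>" and Y: "Y \<subseteq> S"
  obtains W where "\<forall>s\<in>S. W s \<in> words_over Y" "\<forall>s\<in>Y. W s = [(s, False)]"
    "\<And>u v. artin_eq M S u v \<Longrightarrow> artin_eq M S (word_subst W u) (word_subst W v)"
proof -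
  let ?G = "artin_group M S"
  have over: "w \<in> words_over S" if "w \<in> words_over Y" for w
    using that Y by (rule words_over_mono)
  have "\<exists>w\<in>words_over Y. \<phi> (artin_gen M S s) = artin_class M S w" if "s \<in> S" for s
  proof -
    have "artin_gen M S s \<in> carrier ?G" using that by (auto simp: artin_carrier artin_gen_def)
    then have "\<phi> (artin_gen M S s) \<in> parabolic M S Y"
      using ret by (auto simp: is_retraction_def hom_def)
    then show ?thesis by (auto simp: parabolic_eq_classes[OF Y])
  qed
  then obtain V where V: "\<And>s. s \<in> S \<Longrightarrow> V s \<in> words_over Y \<and> \<phi> (artin_gen M S s) = artin_class M S (V s)"
    by metis
  define W where "W s = (if s \<in> Y then [(s, False)] else V s)" for s
  have WY: "\<forall>s\<in>S. W s \<in> words_over Y" using V by (auto simp: W_def)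
  have gen: "\<phi> (artin_class M S [(s, False)]) = artin_class M S (W s)" if "s \<in> S" for s
  proof (cases "s \<in> Y")
    case True
    then have "artin_class M S [(s, False)] \<in> parabolic M S Y"
      by (auto simp: parabolic_eq_classes[OF Y])
    then show ?thesis using ret True by (auto simp: W_def is_retraction_def)
  next
    case False
    then show ?thesis using V that by (auto simp: W_def artin_gen_def)
  qed
  have "\<phi> \<in> hom ?G ?G"
    using ret over by (auto simp: is_retraction_def hom_def Pi_iff parabolic_eq_classes[OF Y] artin_carrier)
  then interpret group_hom ?G ?G \<phi>
    by (simp add: group_hom_def group_hom_axioms_def artin_group_is_group)
  have \<phi>: "\<phi> (artin_class M S w) = artin_class M S (word_subst W w)" if "w \<in> words_over S" for w
    using that
  proof (induction w)
    case Nil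
    then show ?case using hom_one by (simp add: artin_one)
  next
    case (Cons l w)
    obtain s b where l: "l = (s, b)" by (cases l)
    have s: "s \<in> S" "w \<in> words_over S" using Cons.prems by (auto simp: l)
    have Ws: "W s \<in> words_over S" using WY s over by blast
    have 1: "\<phi> (artin_class M S [(s, b)]) = artin_class M S (word_subst W [(s, b)])"
    proof (cases b)
      case True
      have "\<phi> (inv\<^bsub>?G\<^esub> artin_class M S [(s, False)]) = inv\<^bsub>?G\<^esub> \<phi> (artin_class M S [(s, False)])"
        using s by (intro hom_inv) (auto simp: artin_carrier)
      then show ?thesis using s True Ws by (simp add: artin_inv gen)
    next
      case False
      then show ?thesis using gen s by simp
    qed
    have "\<phi> (artin_class M S [(s, b)] \<otimes>\<^bsub>?G\<^esub> artin_class M S w)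
        = \<phi> (artin_class M S [(s, b)]) \<otimes>\<^bsub>?G\<^esub> \<phi> (artin_class M S w)"
      using s by (intro hom_mult) (auto simp: artin_carrier)
    then show ?case
      using 1 Cons.IH s Ws over WY
      by (simp add: artin_mult l word_subst_in_words_over[of S])
  qed
  show thesis
  proof (rule that[of W])
    show "\<forall>s\<in>Y. W s = [(s, False)]" by (simp add: W_def)
    fix u v assume uv: "artin_eq M S u v"
    have "u \<in> words_over S" "v \<in> words_over S" using artin_eq_words_over[OF uv] by auto
    moreover have "artin_class M S u = artin_class M S v"
      using uv calculation by (simp add: artin_class_eq_iff)
    ultimately have "artin_class M S (word_subst W u) = artin_class M S (word_subst W v)"
      using \<phi> by metis
    then show "artin_eq M S (word_subst W u) (word_subst W v)"
      using WY over \<open>u \<in> words_over S\<close>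
      by (subst (asm) artin_class_eq_iff) (auto intro: word_subst_in_words_over[of S])
  qed (rule WY)
qed

lemma ordinary_retraction_of_subst:
  assumes Y: "Y \<subseteq> S"
    and WY: "\<forall>s\<in>S. W s \<in> words_over Y" and Wid: "\<forall>s\<in>Y. W s = [(s, False)]"
    and Word: "\<forall>s\<in>S. W s = [] \<or> (\<exists>z\<in>Y. W s = [(z, False)])"
    and eq: "\<And>u v. artin_eq M S u v \<Longrightarrow> artin_eq M S (word_subst W u) (word_subst W v)"
  shows "\<exists>\<phi>. ordinary_retraction M S Y \<phi>"
proof -
  \<comment> \<open>An arbitrary representative of the class is substituted into; \<open>eq\<close>
    makes the result independent of the choice.\<close>
  define \<phi> where "\<phi> A = artin_class M S (word_subst W (SOME w. w \<in> A))" for A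
  have over: "w \<in> words_over S" if "w \<in> words_over Y" for w
    using that Y by (rule words_over_mono)
  have \<phi>: "\<phi> (artin_class M S w) = artin_class M S (word_subst W w)" if "w \<in> words_over S" for w
  proof -
    have "w \<in> artin_class M S w" using that by (simp add: artin_class_def artin_eq.refl)
    then have "(SOME v. v \<in> artin_class M S w) \<in> artin_class M S w" by (rule someI)
    then have "artin_eq M S w (SOME v. v \<in> artin_class M S w)" by (simp add: artin_class_def)
    from eq[OF this] show ?thesis
      unfolding \<phi>_def using WY that over
      by (subst eq_commute, subst artin_class_eq_iff) (auto intro: word_subst_in_words_over[of S])
  qed
  have subst_over: "word_subst W w \<in> words_over Y" if "w \<in> words_over S" for w
    using WY that by (rule word_subst_in_words_over)
  have "is_retraction (artin_group M S) (parabolic M S Y) \<phi>"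
    unfolding is_retraction_def
  proof (intro conjI ballI homI)
    fix x assume "x \<in> carrier (artin_group M S)"
    then show "\<phi> x \<in> carrier (artin_group M S\<lparr>carrier := parabolic M S Y\<rparr>)"
      using subst_over by (auto simp: artin_carrier \<phi> parabolic_eq_classes[OF Y])
  next
    fix x y assume "x \<in> carrier (artin_group M S)" "y \<in> carrier (artin_group M S)"
    then show "\<phi> (x \<otimes>\<^bsub>artin_group M S\<^esub> y)
        = \<phi> x \<otimes>\<^bsub>artin_group M S\<lparr>carrier := parabolic M S Y\<rparr>\<^esub> \<phi> y"
      using subst_over over by (auto simp: artin_carrier \<phi> artin_mult)
  next
    fix h assume "h \<in> parabolic M S Y"
    then show "\<phi> h = h"
      using over Wid by (auto simp: parabolic_eq_classes[OF Y] \<phi> word_subst_id)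
  qed
  moreover have "\<phi> (artin_gen M S x) = artin_gen M S x" if "x \<in> Y" for x
    using that Y Wid by (auto simp: artin_gen_def \<phi>)
  moreover have "\<phi> (artin_gen M S y) \<in> artin_gen M S ` Y \<union> {\<one>\<^bsub>artin_group M S\<^esub>}" if "y \<in> S - Y" for y
    using that Word by (force simp: artin_gen_def \<phi> artin_one)
  ultimately show ?thesis unfolding ordinary_retraction_def by blast
qed

section \<open>Reflection representations\<close>

text \<open>This is the dual of the representation \<open>s e\<^sub>u = e\<^sub>u + n s u e\<^sub>s\<close>; in the dual, words in \<open>s\<close>
  and \<open>t\<close> act on the coordinates \<open>(x s, x t)\<close> without reference to the other coordinates.\<close>

fun letter_act :: "('s \<Rightarrow> 's \<Rightarrow> complex) \<Rightarrow> 's \<times> bool \<Rightarrow> ('s \<Rightarrow> complex) \<Rightarrow> 's \<Rightarrow> complex" where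
  "letter_act n (s, b) x = (\<lambda>u. if b then x u - n s u * x s / (1 + n s s) else x u + n s u * x s)"

definition word_act :: "('s \<Rightarrow> 's \<Rightarrow> complex) \<Rightarrow> 's aword \<Rightarrow> ('s \<Rightarrow> complex) \<Rightarrow> 's \<Rightarrow> complex" where
  "word_act n w = foldr (letter_act n) w"

lemma word_act_simps [simp]:
  "word_act n [] x = x"
  "word_act n (l # w) x = letter_act n l (word_act n w x)"
  "word_act n (u @ v) x = word_act n u (word_act n v x)"
  by (simp_all add: word_act_def)

lemma word_act_Nil: "word_act n [] = (\<lambda>x. x)"
  and word_act_single: "word_act n [l] = letter_act n l"
  and word_act_append: "word_act n (u @ v) = (\<lambda>x. word_act n u (word_act n v x))"
  by (simp_all add: fun_eq_iff)

text \<open>A letter multiplies its own coordinate \<open>x s\<close> by \<open>1 + n s s\<close>,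
  which is why the inverse letter divides its correction by this factor.\<close>

lemma letter_act_cancel:
  assumes "1 + n s s \<noteq> 0"
  shows "letter_act n (s, b) (letter_act n (s, \<not> b) x) = x"
proof -
  have "x s - n s s * x s / (1 + n s s) = x s / (1 + n s s)"
    "(x s + n s s * x s) / (1 + n s s) = x s"
    using assms by (simp_all add: divide_simps) (simp_all add: algebra_simps)
  then show ?thesis
    by (intro ext) (simp add: times_divide_eq_right[symmetric] del: times_divide_eq_right)
qed

section \<open>Braid relations in the representation\<close>

definition is_rep :: "('s \<Rightarrow> 's \<Rightarrow> enat) \<Rightarrow> 's set \<Rightarrow> ('s \<Rightarrow> 's \<Rightarrow> complex) \<Rightarrow> bool" where
  "is_rep M S n \<longleftrightarrow> (\<forall>s\<in>S. 1 + n s s \<noteq> 0) \<and>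
     (\<forall>s\<in>S. \<forall>t\<in>S. \<forall>m. s \<noteq> t \<longrightarrow> M s t = enat m \<longrightarrow>
        word_act n (alt_word s t m) = word_act n (alt_word t s m))"

lemma word_act_artin_eq:
  assumes "is_rep M S n" "artin_eq M S u v"
  shows "word_act n u = word_act n v"
  using assms(2)
proof (induction rule: artin_eq.induct)
  case (cancel x y s b)
  then show ?case
    using assms(1) letter_act_cancel[of n s b]
    by (intro ext) (simp add: is_rep_def del: letter_act.simps)
next
  case (braid x y s t m)
  then have "word_act n (alt_word s t m) = word_act n (alt_word t s m)"
    using assms(1) unfolding is_rep_def by blast
  then show ?case by (intro ext) simp
qed simp_all

text \<open>With both coefficients 0 the products of the two rank-one parts vanish, so the letters
  commute, and an even alternating word contains each of them \<open>k\<close> times.\<close>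

lemma braid_commuting:
  assumes "n s t = 0" "n t s = 0"
  shows "word_act n (alt_word s t (2 * k)) = word_act n (alt_word t s (2 * k))"
proof (induction k)
  case (Suc k)
  have "alt_word a b (2 * Suc k) = (a, False) # (b, False) # alt_word a b (2 * k)" for a b :: 'a
    by simp
  then show ?case
    by (intro ext) (simp add: Suc.IH assms del: alt_word.simps)
qed simp

text \<open>The operators \<open>E\<^sub>s x = (\<lambda>u. n s u * x s)\<close> and \<open>E\<^sub>t\<close> satisfy \<open>E\<^sub>s\<^sup>2 = (q - 1) E\<^sub>s\<close> and
  \<open>E\<^sub>s E\<^sub>t E\<^sub>s = r\<^sup>2 E\<^sub>s\<close>, so an alternating word of odd length, being a palindrome, is of the form
  \<open>1 + a E\<^sub>s + b E\<^sub>t + d (E\<^sub>s E\<^sub>t + E\<^sub>t E\<^sub>s)\<close>. Exchanging \<open>s\<close> and \<open>t\<close> exchanges \<open>a\<close> and \<open>b\<close>, and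
  \<open>a - b\<close> is a Chebyshev polynomial, which vanishes at the roots of unity.\<close>

lemma odd_alt_word_act:
  fixes q r \<zeta> :: complex
  assumes n: "n s s = q - 1" "n t t = q - 1" "n s t = r" "n t s = r"
    and \<zeta>: "\<zeta> \<noteq> 0" "\<zeta>\<^sup>2 \<noteq> 1" and r: "r\<^sup>2 = - q * (\<zeta> + 2 + 1 / \<zeta>)"
  shows "\<exists>a b d.
    (\<forall>x u. word_act n (alt_word s t (2 * j + 1)) x u =
       x u + n s u * (a * x s + d * r * x t) + n t u * (b * x t + d * r * x s)) \<and>
    (\<forall>x u. word_act n (alt_word t s (2 * j + 1)) x u =
       x u + n t u * (a * x t + d * r * x s) + n s u * (b * x s + d * r * x t)) \<and>
    a = 1 + q * b + r\<^sup>2 * d \<and>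
    (a - b) * (\<zeta> - 1) = (- q / \<zeta>) ^ j * (\<zeta> ^ (2 * j + 1) - 1) \<and>
    (a + (q - 1) * d) * (\<zeta>\<^sup>2 - 1) = (- q / \<zeta>) ^ j * (\<zeta> ^ (2 * j + 2) - 1)"
proof (induction j)
  case 0
  show ?case
    by (rule exI[of _ 1], rule exI[of _ 0], rule exI[of _ 0])
       (simp add: power2_eq_square)
next
  case (Suc j)
  then obtain a b d where
    st: "\<And>x u. word_act n (alt_word s t (2 * j + 1)) x u =
       x u + n s u * (a * x s + d * r * x t) + n t u * (b * x t + d * r * x s)"
    and ts: "\<And>x u. word_act n (alt_word t s (2 * j + 1)) x u =
       x u + n t u * (a * x t + d * r * x s) + n s u * (b * x s + d * r * x t)"
    and a: "a = 1 + q * b + r\<^sup>2 * d"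
    and A: "(a - b) * (\<zeta> - 1) = (- q / \<zeta>) ^ j * (\<zeta> ^ (2 * j + 1) - 1)"
    and e: "(a + (q - 1) * d) * (\<zeta>\<^sup>2 - 1) = (- q / \<zeta>) ^ j * (\<zeta> ^ (2 * j + 2) - 1)"
    by blast
  define d' where "d' = a + q * d"
  define a' where "a' = 1 + q * a + r\<^sup>2 * d'"
  \<comment> \<open>The companion \<open>a + (q - 1) * d\<close> equals \<open>d' - d\<close>, the
    difference of the two mixed coefficients in the even word of length \<open>2 * j + 2\<close>.
    Odd and even differences together form a closed recursion.\<close>
  have a'a: "a' - a = q * (a - b) + r\<^sup>2 * (a + (q - 1) * d)"
    unfolding a'_def d'_def a by (simp add: algebra_simps)
  define Z where "Z = \<zeta> ^ (2 * j)"
  define p where "p = - q / \<zeta>"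
  have q: "q = - p * \<zeta>" using \<zeta> by (simp add: p_def)
  have r': "r\<^sup>2 = p * (\<zeta> + 1)\<^sup>2"
    unfolding r q using \<zeta> by (simp add: field_simps power2_eq_square)
  have A': "(a - b) * (\<zeta> - 1) = p ^ j * (Z * \<zeta> - 1)"
    using A by (simp add: Z_def p_def mult.commute)
  have e': "(a + (q - 1) * d) * (\<zeta>\<^sup>2 - 1) = p ^ j * (Z * \<zeta>\<^sup>2 - 1)"
    using e unfolding Z_def p_def power_add by (simp only: )

  have "(a' - a) * (\<zeta> - 1) = q * ((a - b) * (\<zeta> - 1)) + p * (\<zeta> + 1) * ((a + (q - 1) * d) * (\<zeta>\<^sup>2 - 1))"
    unfolding a'a r' by (simp add: algebra_simps power2_eq_square)
  also have "\<dots> = p ^ Suc j * (Z * \<zeta> ^ 3 - 1)"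
    unfolding A' e' unfolding q by (simp add: algebra_simps power2_eq_square power3_eq_cube)
  finally have A'': "(a' - a) * (\<zeta> - 1) = p ^ Suc j * (Z * \<zeta> ^ 3 - 1)" .
  have "(a' + (q - 1) * d') * (\<zeta>\<^sup>2 - 1)
      = (\<zeta> + 1) * ((a' - a) * (\<zeta> - 1)) + q * ((a + (q - 1) * d) * (\<zeta>\<^sup>2 - 1))"
    unfolding d'_def by (simp add: algebra_simps power2_eq_square)
  also have "\<dots> = p ^ Suc j * (Z * \<zeta> ^ 4 - 1)"
    unfolding A'' e' unfolding q by (simp add: algebra_simps eval_nat_numeral)
  finally have e'': "(a' + (q - 1) * d') * (\<zeta>\<^sup>2 - 1) = p ^ Suc j * (Z * \<zeta> ^ 4 - 1)" .
  have Z: "\<zeta> ^ (2 * Suc j + 1) = Z * \<zeta> ^ 3" "\<zeta> ^ (2 * Suc j + 2) = Z * \<zeta> ^ 4"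
    by (simp_all add: Z_def eval_nat_numeral algebra_simps)
  show ?case
  proof (rule exI[of _ a'], rule exI[of _ a], rule exI[of _ d'], intro conjI allI)
    fix x u
    have step: "word_act n (alt_word s t (2 * Suc j + 1)) x =
        letter_act n (s, False) (letter_act n (t, False) (word_act n (alt_word s t (2 * j + 1)) x))"
      by simp
    show "word_act n (alt_word s t (2 * Suc j + 1)) x u =
       x u + n s u * (a' * x s + d' * r * x t) + n t u * (a * x t + d' * r * x s)"
      unfolding step letter_act.simps st if_False n
      by (simp add: a'_def d'_def a algebra_simps power2_eq_square)
    have step: "word_act n (alt_word t s (2 * Suc j + 1)) x =
        letter_act n (t, False) (letter_act n (s, False) (word_act n (alt_word t s (2 * j + 1)) x))"
      by simp
    show "word_act n (alt_word t s (2 * Suc j + 1)) x u =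
       x u + n t u * (a' * x t + d' * r * x s) + n s u * (a * x s + d' * r * x t)"
      unfolding step letter_act.simps ts if_False n
      by (simp add: a'_def d'_def a algebra_simps power2_eq_square)
  next
    show "(a' - a) * (\<zeta> - 1) = (- q / \<zeta>) ^ Suc j * (\<zeta> ^ (2 * Suc j + 1) - 1)"
      unfolding p_def[symmetric] Z by (rule A'')
    show "(a' + (q - 1) * d') * (\<zeta>\<^sup>2 - 1) = (- q / \<zeta>) ^ Suc j * (\<zeta> ^ (2 * Suc j + 2) - 1)"
      unfolding p_def[symmetric] Z by (rule e'')
  qed (simp add: a'_def)
qed

lemma braid_odd:
  fixes q r \<zeta> :: complex
  assumes n: "n s s = q - 1" "n t t = q - 1" "n s t = r" "n t s = r"
    and m: "odd m" and \<zeta>: "\<zeta> ^ m = 1" "\<zeta> \<noteq> 1" and r: "r\<^sup>2 = - q * (\<zeta> + 2 + 1 / \<zeta>)"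
  shows "word_act n (alt_word s t m) = word_act n (alt_word t s m)"
proof -
  obtain j where j: "m = 2 * j + 1" using m by (elim oddE)
  have "\<zeta> \<noteq> 0" using \<zeta> j by auto
  moreover have "\<zeta>\<^sup>2 \<noteq> 1"
  proof
    assume "\<zeta>\<^sup>2 = 1"
    then have "\<zeta> ^ m = \<zeta>" by (simp add: j power_mult)
    then show False using \<zeta> by simp
  qed
  ultimately obtain a b d where
    st: "\<And>x u. word_act n (alt_word s t m) x u =
       x u + n s u * (a * x s + d * r * x t) + n t u * (b * x t + d * r * x s)"
    and ts: "\<And>x u. word_act n (alt_word t s m) x u =
       x u + n t u * (a * x t + d * r * x s) + n s u * (b * x s + d * r * x t)"
    and "(a - b) * (\<zeta> - 1) = (- q / \<zeta>) ^ j * (\<zeta> ^ m - 1)"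
    using odd_alt_word_act[where n = n and s = s and t = t and j = j, OF n _ _ r]
    unfolding j by blast
  then have "a = b" using \<zeta> by simp
  then show ?thesis by (intro ext) (simp add: st ts)
qed

section \<open>Triangular matrices\<close>

text \<open>A triple \<open>(\<rho>, \<kappa>, \<tau>)\<close> stands for the upper triangular matrix with diagonal \<open>\<rho>, \<tau>\<close> and
  off-diagonal entry \<open>\<kappa>\<close>.\<close>

type_synonym tri = "complex \<times> complex \<times> complex"

fun tri_mult :: "tri \<Rightarrow> tri \<Rightarrow> tri" where
  "tri_mult (\<rho>, \<kappa>, \<tau>) (\<rho>', \<kappa>', \<tau>') = (\<rho> * \<rho>', \<rho> * \<kappa>' + \<kappa> * \<tau>', \<tau> * \<tau>')"

fun tri_alt :: "tri \<Rightarrow> tri \<Rightarrow> nat \<Rightarrow> tri" where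
  "tri_alt P R 0 = (1, 0, 1)"
| "tri_alt P R (Suc m) = tri_mult P (tri_alt R P m)"

lemma tri_alt_odd_diag:
  "\<exists>\<kappa>''. tri_alt (\<rho>, \<kappa>, \<tau>) (\<rho>', \<kappa>', \<tau>') (2 * j + 1) =
    (\<rho> * (\<rho> * \<rho>') ^ j, \<kappa>'', \<tau> * (\<tau> * \<tau>') ^ j)"
proof (induction j)
  case (Suc j)
  then obtain \<kappa>'' where
    "tri_alt (\<rho>, \<kappa>, \<tau>) (\<rho>', \<kappa>', \<tau>') (2 * j + 1) = (\<rho> * (\<rho> * \<rho>') ^ j, \<kappa>'', \<tau> * (\<tau> * \<tau>') ^ j)"
    by blast
  moreover have "tri_alt P R (2 * Suc j + 1) = tri_mult P (tri_mult R (tri_alt P R (2 * j + 1)))" for P R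
    by simp
  ultimately show ?case by (simp del: tri_alt.simps add: algebra_simps)
qed simp

text \<open>Diagonal entries are multiplicative, and in an odd relation the two sides differ by one
  occurrence of each letter; the common nonzero factors cancel.\<close>

lemma tri_alt_odd_eq_diag:
  assumes eq: "tri_alt P R m = tri_alt R P m" "odd m"
    and nz: "fst P \<noteq> 0 \<and> snd (snd P) \<noteq> 0" "fst R \<noteq> 0 \<and> snd (snd R) \<noteq> 0"
  shows "fst P = fst R" "snd (snd P) = snd (snd R)"
proof -
  obtain \<rho> \<kappa> \<tau> \<rho>' \<kappa>' \<tau>' where PR: "P = (\<rho>, \<kappa>, \<tau>)" "R = (\<rho>', \<kappa>', \<tau>')" by (cases P, cases R)
  obtain j where j: "m = 2 * j + 1" using eq(2) by (elim oddE)
  have "\<rho> * (\<rho> * \<rho>') ^ j = \<rho>' * (\<rho>' * \<rho>) ^ j" "\<tau> * (\<tau> * \<tau>') ^ j = \<tau>' * (\<tau>' * \<tau>) ^ j"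
    using tri_alt_odd_diag[of \<rho> \<kappa> \<tau> \<rho>' \<kappa>' \<tau>' j] tri_alt_odd_diag[of \<rho>' \<kappa>' \<tau>' \<rho> \<kappa> \<tau> j] eq(1)
    unfolding j PR by auto
  then show "fst P = fst R" "snd (snd P) = snd (snd R)"
    using nz by (auto simp: PR mult.commute[of \<rho>'] mult.commute[of \<tau>'])
qed

text \<open>These matrices are affine maps with slope \<rho>, and the translation parts differ by
  \<open>\<kappa> - \<kappa>'\<close> times a geometric sum in \<open>- \<rho>\<close>. The factor
  \<open>1 + \<rho>\<close> clears its denominator.\<close>

lemma tri_alt_unipotent_quotient:
  "\<exists>\<alpha> \<beta>. tri_alt (\<rho>, \<kappa>, 1) (\<rho>, \<kappa>', 1) m = (\<rho> ^ m, \<alpha>, 1) \<and>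
    tri_alt (\<rho>, \<kappa>', 1) (\<rho>, \<kappa>, 1) m = (\<rho> ^ m, \<beta>, 1) \<and>
    (1 + \<rho>) * (\<alpha> - \<beta>) = (\<kappa> - \<kappa>') * (1 - (- \<rho>) ^ m)"
proof (induction m)
  case (Suc m)
  then obtain \<alpha> \<beta> where *: "tri_alt (\<rho>, \<kappa>, 1) (\<rho>, \<kappa>', 1) m = (\<rho> ^ m, \<alpha>, 1)"
    "tri_alt (\<rho>, \<kappa>', 1) (\<rho>, \<kappa>, 1) m = (\<rho> ^ m, \<beta>, 1)"
    "(1 + \<rho>) * (\<alpha> - \<beta>) = (\<kappa> - \<kappa>') * (1 - (- \<rho>) ^ m)" by blast
  have "(1 + \<rho>) * ((\<rho> * \<beta> + \<kappa>) - (\<rho> * \<alpha> + \<kappa>')) = (1 + \<rho>) * (\<kappa> - \<kappa>') - \<rho> * ((1 + \<rho>) * (\<alpha> - \<beta>))"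
    by (simp add: algebra_simps)
  also have "\<dots> = (\<kappa> - \<kappa>') * (1 - (- \<rho>) ^ Suc m)"
    unfolding *(3) by (simp add: algebra_simps)
  finally show ?case using * by simp
qed simp

lemma tri_alt_eq_unipotent_quotient:
  assumes "tri_alt (\<rho>, \<kappa>, 1) (\<rho>, \<kappa>', 1) m = tri_alt (\<rho>, \<kappa>', 1) (\<rho>, \<kappa>, 1) m"
  shows "\<kappa> = \<kappa>' \<or> (- \<rho>) ^ m = 1"
  using tri_alt_unipotent_quotient[of \<rho> \<kappa> \<kappa>' m] assms by auto

text \<open>The two products of the matrices have the same diagonal \<open>q, p\<close> and
  off-diagonal entries \<open>q\<close> and 1. Their k-th powers multiply these entries by the same
  sum \<sigma> of the monomials of degree k - 1 in \<open>q\<close> and \<open>p\<close>.\<close>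

lemma tri_alt_even:
  "\<exists>\<sigma>. tri_alt (q, 0, 1) (1, 1, p) (2 * k) = (q ^ k, q * \<sigma>, p ^ k) \<and>
    tri_alt (1, 1, p) (q, 0, 1) (2 * k) = (q ^ k, \<sigma>, p ^ k) \<and> (q - p) * \<sigma> = q ^ k - p ^ k"
proof (induction k)
  case (Suc k)
  then obtain \<sigma> where *: "tri_alt (q, 0, 1) (1, 1, p) (2 * k) = (q ^ k, q * \<sigma>, p ^ k)"
    "tri_alt (1, 1, p) (q, 0, 1) (2 * k) = (q ^ k, \<sigma>, p ^ k)" "(q - p) * \<sigma> = q ^ k - p ^ k" by blast
  have "(q - p) * (q * \<sigma> + p ^ k) = q * ((q - p) * \<sigma>) + (q - p) * p ^ k"
    by (simp add: algebra_simps)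
  also have "\<dots> = q ^ Suc k - p ^ Suc k" unfolding *(3) by (simp add: algebra_simps)
  finally have "(q - p) * (q * \<sigma> + p ^ k) = q ^ Suc k - p ^ Suc k" .
  moreover have "tri_alt P R (2 * Suc k) = tri_mult P (tri_mult R (tri_alt P R (2 * k)))" for P R
    by simp
  ultimately show ?case
    using *(1,2) by (intro exI[of _ "q * \<sigma> + p ^ k"]) (simp del: tri_alt.simps)
qed simp

text \<open>Stated through two functionals instead of basis vectors, since the action is given in
  coordinates. The column of values (U, V) is multiplied by \<open>P\<close>, so composition of maps
  matches matrix multiplication in the same order. Nonzero diagonals allow inverse letters.\<close>

definition acts_tri :: "('v \<Rightarrow> complex) \<Rightarrow> ('v \<Rightarrow> complex) \<Rightarrow> ('v \<Rightarrow> 'v) \<Rightarrow> tri \<Rightarrow> bool" where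
  "acts_tri U V F P \<longleftrightarrow> (case P of (\<rho>, \<kappa>, \<tau>) \<Rightarrow>
     \<rho> \<noteq> 0 \<and> \<tau> \<noteq> 0 \<and> (\<forall>x. U (F x) = \<rho> * U x + \<kappa> * V x \<and> V (F x) = \<tau> * V x))"

lemma acts_tri_id: "acts_tri U V (\<lambda>x. x) (1, 0, 1)"
  by (simp add: acts_tri_def)

lemma acts_tri_comp:
  "acts_tri U V F P \<Longrightarrow> acts_tri U V G R \<Longrightarrow> acts_tri U V (\<lambda>x. F (G x)) (tri_mult P R)"
  by (cases P, cases R) (auto simp: acts_tri_def algebra_simps)

lemma acts_tri_inverse:
  assumes "acts_tri U V F P" "\<And>x. F (G x) = x"
  shows "\<exists>R. acts_tri U V G R"
proof -
  obtain \<rho> \<kappa> \<tau> where P: "P = (\<rho>, \<kappa>, \<tau>)" by (cases P)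
  have nz: "\<rho> \<noteq> 0" "\<tau> \<noteq> 0" using assms(1) by (auto simp: P acts_tri_def)
  have FG: "U (F (G x)) = \<rho> * U (G x) + \<kappa> * V (G x) \<and> V (F (G x)) = \<tau> * V (G x)" for x
    using assms(1) by (simp add: P acts_tri_def)
  have UG: "U x = \<rho> * U (G x) + \<kappa> * V (G x)" and VG: "V x = \<tau> * V (G x)" for x
    using FG[of x] unfolding assms(2) by blast+
  have "V (G x) = 1 / \<tau> * V x" "U (G x) = 1 / \<rho> * U x + (- \<kappa> / (\<rho> * \<tau>)) * V x" for x
    using nz by (simp_all add: UG[of x] VG[of x] field_simps)
  then have "acts_tri U V G (1 / \<rho>, - \<kappa> / (\<rho> * \<tau>), 1 / \<tau>)"
    using nz unfolding acts_tri_def by simp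
  then show ?thesis by blast
qed

text \<open>The points \<open>x\<close> and \<open>y\<close> are dual to the functionals and read
  off the columns of the matrix. This turns an equality of operators into one of matrices.\<close>

lemma acts_tri_unique:
  assumes "acts_tri U V F P" "acts_tri U V F R" "U x = 1" "V x = 0" "U y = 0" "V y = 1"
  shows "P = R"
proof -
  obtain \<rho> \<kappa> \<tau> \<rho>' \<kappa>' \<tau>' where PR: "P = (\<rho>, \<kappa>, \<tau>)" "R = (\<rho>', \<kappa>', \<tau>')" by (cases P, cases R)
  have "\<rho> * U z + \<kappa> * V z = \<rho>' * U z + \<kappa>' * V z" "\<tau> * V z = \<tau>' * V z" for z
    using assms(1,2) by (auto simp: PR acts_tri_def)
  from this(1)[of x] this(1,2)[of y] show ?thesis using assms by (simp add: PR)
qed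

lemma acts_tri_alt_word:
  assumes "acts_tri U V (word_act n (W s)) P" "acts_tri U V (word_act n (W t)) R"
  shows "acts_tri U V (word_act n (word_subst W (alt_word s t m))) (tri_alt P R m)"
  using assms
proof (induction m arbitrary: s t P R)
  case 0
  then show ?case by (simp add: word_act_Nil acts_tri_id)
next
  case (Suc m)
  from acts_tri_comp[OF Suc.prems(1) Suc.IH[OF Suc.prems(2,1)]]
  show ?case by (simp add: word_act_append)
qed

lemma word_subst_singletons [simp]: "word_subst (\<lambda>s. [(s, False)]) w = w"
  by (induction w) auto

lemma acts_tri_words:
  assumes "1 + n a a \<noteq> 0" "1 + n b b \<noteq> 0"
    and "acts_tri U V (word_act n [(a, False)]) P" "acts_tri U V (word_act n [(b, False)]) R"
    and "w \<in> words_over {a, b}"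
  shows "\<exists>Q. acts_tri U V (word_act n w) Q"
  using assms(5)
proof (induction w)
  case Nil
  show ?case using acts_tri_id[of U V] by (auto simp: word_act_Nil)
next
  case (Cons l w)
  obtain s c where l: "l = (s, c)" by (cases l)
  have s: "s \<in> {a, b}" "w \<in> words_over {a, b}" using Cons.prems by (auto simp: l)
  obtain Q where Q: "acts_tri U V (letter_act n (s, False)) Q"
    using s assms(3,4)[unfolded word_act_single] by blast
  have "\<exists>Q. acts_tri U V (letter_act n (s, c)) Q"
  proof (cases c)
    case True
    have "letter_act n (s, False) (letter_act n (s, True) x) = x" for x
      using letter_act_cancel[of n s False x] assms(1,2) s by auto
    from acts_tri_inverse[OF Q this] show ?thesis using True by (simp del: letter_act.simps)
  next
    case False
    then show ?thesis using Q by metis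
  qed
  moreover obtain Q' where "acts_tri U V (word_act n w) Q'" using Cons.IH s by auto
  ultimately obtain Q'' where "acts_tri U V (\<lambda>x. letter_act n (s, c) (word_act n w x)) Q''"
    using acts_tri_comp by blast
  moreover have "word_act n (l # w) = (\<lambda>x. letter_act n (s, c) (word_act n w x))"
    by (simp add: l fun_eq_iff)
  ultimately show ?case by metis
qed

text \<open>Words in \<open>z\<close> and \<open>t\<close> move \<open>x\<close> by combinations of
  the rows \<open>n z\<close> and \<open>n t\<close>. On the coordinates \<open>z, t\<close> these
  rows form a triangular matrix with nonzero diagonal \<open>q - 1, p - 1\<close>, so agreement on
  two coordinates gives agreement everywhere; there it follows from \<sigma> = 0.\<close>

lemma braid_even:
  assumes zt: "n z t = 0" and q: "n z z = q - 1" "q \<noteq> 1" and p: "n t t = p - 1" "p \<noteq> 1"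
    and nz: "q \<noteq> 0" "p \<noteq> 0" and tz: "n t z = 1" and qp: "q \<noteq> p" "q ^ k = p ^ k"
  shows "word_act n (alt_word z t (2 * k)) = word_act n (alt_word t z (2 * k))"
proof -
  have disp: "\<exists>\<alpha> \<beta>. \<forall>u. word_act n (alt_word a b m) x u = x u + n z u * \<alpha> + n t u * \<beta>"
    if "{a, b} = {z, t}" for a b m x
    using that
  proof (induction m arbitrary: a b)
    case 0
    then show ?case by (intro exI[of _ 0]) simp
  next
    case (Suc m)
    then obtain \<alpha> \<beta> where *: "\<And>u. word_act n (alt_word b a m) x u = x u + n z u * \<alpha> + n t u * \<beta>"
      by (metis insert_commute)
    have "a = z \<or> a = t" using Suc.prems by blast
    then show ?case
    proof
      assume "a = z"
      then show ?thesis
        by (rule_tac exI[of _ "\<alpha> + (x z + n z z * \<alpha> + n t z * \<beta>)"], rule_tac exI[of _ \<beta>])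
           (simp add: *[unfolded \<open>a = z\<close>] algebra_simps)
    next
      assume "a = t"
      then show ?thesis
        by (rule_tac exI[of _ \<alpha>], rule_tac exI[of _ "\<beta> + (x t + n z t * \<alpha> + n t t * \<beta>)"])
           (simp add: *[unfolded \<open>a = t\<close>] algebra_simps)
    qed
  qed
  let ?U = "\<lambda>x :: 'a \<Rightarrow> complex. x z" and ?V = "\<lambda>x :: 'a \<Rightarrow> complex. x t"
  have z: "acts_tri ?U ?V (word_act n [(z, False)]) (q, 0, 1)"
    and t: "acts_tri ?U ?V (word_act n [(t, False)]) (1, 1, p)"
    using assms by (auto simp: acts_tri_def algebra_simps)
  obtain \<sigma> where \<sigma>: "tri_alt (q, 0, 1) (1, 1, p) (2 * k) = (q ^ k, q * \<sigma>, p ^ k)"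
    "tri_alt (1, 1, p) (q, 0, 1) (2 * k) = (q ^ k, \<sigma>, p ^ k)" "(q - p) * \<sigma> = q ^ k - p ^ k"
    using tri_alt_even[of q p k] by blast
  have "\<sigma> = 0" using \<sigma>(3) qp by simp
  have A: "acts_tri ?U ?V (word_act n (alt_word z t (2 * k))) (q ^ k, 0, p ^ k)"
    "acts_tri ?U ?V (word_act n (alt_word t z (2 * k))) (q ^ k, 0, p ^ k)"
    using acts_tri_alt_word[where W = "\<lambda>s. [(s, False)]" and m = "2 * k", OF z t]
      acts_tri_alt_word[where W = "\<lambda>s. [(s, False)]" and m = "2 * k", OF t z] \<sigma> \<open>\<sigma> = 0\<close>
    by auto
  show ?thesis
  proof (rule ext)
    fix x
    obtain \<alpha> \<beta> where 1: "\<And>u. word_act n (alt_word z t (2 * k)) x u = x u + n z u * \<alpha> + n t u * \<beta>"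
      using disp[of z t] by blast
    obtain \<alpha>' \<beta>' where 2: "\<And>u. word_act n (alt_word t z (2 * k)) x u = x u + n z u * \<alpha>' + n t u * \<beta>'"
      using disp[of t z] by blast
    have eq: "word_act n (alt_word z t (2 * k)) x z = word_act n (alt_word t z (2 * k)) x z"
      "word_act n (alt_word z t (2 * k)) x t = word_act n (alt_word t z (2 * k)) x t"
      using A by (auto simp: acts_tri_def)
    have "\<beta> = \<beta>'" using eq(2) p zt by (simp add: 1 2)
    moreover from this have "\<alpha> = \<alpha>'" using eq(1) q by (simp add: 1 2)
    ultimately show "word_act n (alt_word z t (2 * k)) x = word_act n (alt_word t z (2 * k)) x"
      by (intro ext) (simp add: 1 2)
  qed
qed

text \<open>\<open>P s\<close> is the matrix of the word that the retraction assigns to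
  \<open>s\<close>. The letter \<open>s\<close> itself may fail to act triangularly, but its image
  is a word in \<open>a\<close> and \<open>b\<close>. These words satisfy the braid relations in the
  whole group, on which the representation is defined.\<close>

lemma retraction_tri:
  assumes ret: "parabolic_retractable M S" and rep: "is_rep M S n"
    and ab: "a \<in> S" "b \<in> S"
    and A: "acts_tri U V (word_act n [(a, False)]) A"
    and B: "acts_tri U V (word_act n [(b, False)]) B"
    and UV: "U x = 1" "V x = 0" "U y = 0" "V y = 1"
  obtains P where "P a = A" "P b = B"
    "\<And>s. s \<in> S \<Longrightarrow> fst (P s) \<noteq> 0 \<and> snd (snd (P s)) \<noteq> 0"
    "\<And>s t m. s \<in> S \<Longrightarrow> t \<in> S \<Longrightarrow> s \<noteq> t \<Longrightarrow> M s t = enat m \<Longrightarrow>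
       tri_alt (P s) (P t) m = tri_alt (P t) (P s) m"
proof -
  obtain \<phi> where "is_retraction (artin_group M S) (parabolic M S {a, b}) \<phi>"
    using ret ab unfolding parabolic_retractable_def by (meson empty_subsetI insert_subset)
  then obtain W where W: "\<forall>s\<in>S. W s \<in> words_over {a, b}" "\<forall>s\<in>{a, b}. W s = [(s, False)]"
    "\<And>u v. artin_eq M S u v \<Longrightarrow> artin_eq M S (word_subst W u) (word_subst W v)"
    using ab by (elim retraction_word_subst) auto
  have "\<exists>Q. acts_tri U V (word_act n (W s)) Q" if "s \<in> S" for s
    using W(1) that rep ab by (intro acts_tri_words[OF _ _ A B]) (auto simp: is_rep_def)
  then obtain P where P: "\<And>s. s \<in> S \<Longrightarrow> acts_tri U V (word_act n (W s)) (P s)" by metis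
  have "P a = A" "P b = B"
    using P[OF ab(1)] P[OF ab(2)] A B W(2) UV by (auto intro: acts_tri_unique)
  moreover have "fst (P s) \<noteq> 0 \<and> snd (snd (P s)) \<noteq> 0" if "s \<in> S" for s
    using P[OF that] by (auto simp: acts_tri_def split: prod.splits)
  moreover have "tri_alt (P s) (P t) m = tri_alt (P t) (P s) m"
    if "s \<in> S" "t \<in> S" "s \<noteq> t" "M s t = enat m" for s t m
  proof -
    have "artin_eq M S ([] @ alt_word s t m @ []) ([] @ alt_word t s m @ [])"
      using that by (intro artin_eq.braid) auto
    then have "word_act n (word_subst W (alt_word s t m)) = word_act n (word_subst W (alt_word t s m))"
      using W(3) word_act_artin_eq[OF rep] by simp
    then show ?thesis
      using acts_tri_alt_word[OF P[OF that(1)] P[OF that(2)], of m]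
        acts_tri_alt_word[OF P[OF that(2)] P[OF that(1)], of m] UV
      by (auto intro: acts_tri_unique)
  qed
  ultimately show thesis by (rule that)
qed

section \<open>Labels of parabolic-retractable Artin groups\<close>

definition unity_root :: "nat \<Rightarrow> complex" where
  "unity_root m = cis (2 * pi / real m)"

lemma unity_root_power_eq_1_iff:
  assumes "m > 0"
  shows "unity_root m ^ k = 1 \<longleftrightarrow> m dvd k"
proof -
  have pow: "unity_root m ^ i = cis (2 * pi * real i / real m)" for i
    by (simp add: unity_root_def DeMoivre mult_ac)
  have m: "unity_root m ^ m = 1"
    using assms by (simp add: pow complex_eq_iff)
  have "unity_root m ^ k = unity_root m ^ (m * (k div m) + k mod m)" by simp
  also have "\<dots> = unity_root m ^ (k mod m)" unfolding power_add power_mult m by simp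
  finally have "unity_root m ^ k = unity_root m ^ (k mod m)" .
  moreover have "unity_root m ^ (k mod m) = 1 \<longleftrightarrow> k mod m = 0"
  proof
    assume "unity_root m ^ (k mod m) = 1"
    then have "cis (2 * pi * real (k mod m) / real m) = cis (2 * pi * real 0 / real m)"
      by (simp add: pow)
    then show "k mod m = 0"
      using bij_betw_imp_inj_on[OF bij_betw_roots_unity[OF assms]] assms
      unfolding inj_on_def by (metis lessThan_iff mod_less_divisor)
  qed simp
  ultimately show ?thesis by (simp add: dvd_eq_mod_eq_0)
qed

definition odd_label :: "('s \<Rightarrow> 's \<Rightarrow> enat) \<Rightarrow> 's \<Rightarrow> 's \<Rightarrow> bool" where
  "odd_label M s t \<longleftrightarrow> (\<exists>m. M s t = enat m \<and> odd m)"

text \<open>For \<open>e = enat m\<close> this is \<open>- 4 q cos\<^sup>2 (\<pi> / m)\<close>, the value of \<open>n s t * n t s\<close> forced by the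
  braid relation of length \<open>m\<close>.\<close>

definition braid_square :: "complex \<Rightarrow> enat \<Rightarrow> complex" where
  "braid_square q e = (let \<zeta> = unity_root (the_enat e) in - q * (\<zeta> + 2 + 1 / \<zeta>))"

lemma coxeter_matrix_sym:
  "coxeter_matrix M S \<Longrightarrow> s \<in> S \<Longrightarrow> t \<in> S \<Longrightarrow> M s t = M t s"
  by (cases "s = t") (auto simp: coxeter_matrix_def)

lemma coxeter_matrix_ge_2:
  assumes "coxeter_matrix M S" "s \<in> S" "t \<in> S" "s \<noteq> t" "M s t = enat m"
  shows "m \<ge> 2"
proof -
  have "2 \<le> M s t" using assms(1-4) unfolding coxeter_matrix_def by blast
  then show ?thesis by (simp add: assms(5) numeral_eq_enat)
qed

lemma odd_label_refl: "coxeter_matrix M S \<Longrightarrow> s \<in> S \<Longrightarrow> odd_label M s s"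
  by (auto simp: coxeter_matrix_def odd_label_def one_enat_def)

lemma odd_label_sym: "coxeter_matrix M S \<Longrightarrow> s \<in> S \<Longrightarrow> t \<in> S \<Longrightarrow> odd_label M s t \<longleftrightarrow> odd_label M t s"
  by (simp add: odd_label_def coxeter_matrix_sym)

text \<open>Odd relations are settled uniformly by a root of unity of order \<open>m\<close>, which
  forces \<open>q\<close> to be constant along odd labels. Even relations are left open because one
  application needs a noncommuting pair.\<close>

lemma is_repI:
  assumes cox: "coxeter_matrix M S"
    and diag: "\<And>s. s \<in> S \<Longrightarrow> n s s = q s - 1 \<and> q s \<noteq> 0"
    and odd: "\<And>s t. s \<in> S \<Longrightarrow> t \<in> S \<Longrightarrow> s \<noteq> t \<Longrightarrow> odd_label M s t \<Longrightarrow>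
      q s = q t \<and> n s t = n t s \<and> (n s t)\<^sup>2 = braid_square (q s) (M s t)"
    and even: "\<And>s t k. s \<in> S \<Longrightarrow> t \<in> S \<Longrightarrow> s \<noteq> t \<Longrightarrow> M s t = enat (2 * k) \<Longrightarrow>
      word_act n (alt_word s t (2 * k)) = word_act n (alt_word t s (2 * k))"
  shows "is_rep M S n"
  unfolding is_rep_def
proof (intro conjI ballI allI impI)
  fix s assume "s \<in> S"
  then show "1 + n s s \<noteq> 0" using diag by simp
next
  fix s t m assume st: "s \<in> S" "t \<in> S" "s \<noteq> t" "M s t = enat m"
  have m: "m \<ge> 2" using coxeter_matrix_ge_2[OF cox st] .
  show "word_act n (alt_word s t m) = word_act n (alt_word t s m)"
  proof (cases "odd m")
    case True
    then have *: "q s = q t" "n s t = n t s" "(n s t)\<^sup>2 = braid_square (q s) (M s t)"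
      using odd[of s t] st by (auto simp: odd_label_def)
    show ?thesis
    proof (rule braid_odd[where \<zeta> = "unity_root m" and q = "q s" and r = "n s t"])
      show "unity_root m ^ m = 1" using m by (simp add: unity_root_power_eq_1_iff)
      show "unity_root m \<noteq> 1" using m unity_root_power_eq_1_iff[of m 1] by auto
    qed (use * st diag True in \<open>auto simp: braid_square_def Let_def\<close>)
  next
    case False
    then show ?thesis using even[of s t "m div 2"] st by simp
  qed
qed

text \<open>Either square root would satisfy the odd relation; the principal one depends only on
  \<open>q\<close> and the label and is therefore symmetric in \<open>s\<close> and
  \<open>t\<close>. The value 0 elsewhere makes even relations commutations.\<close>

definition braid_coeff :: "('s \<Rightarrow> 's \<Rightarrow> enat) \<Rightarrow> complex \<Rightarrow> 's \<Rightarrow> 's \<Rightarrow> complex" where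
  "braid_coeff M q s t = (if odd_label M s t then csqrt (braid_square q (M s t)) else 0)"

text \<open>If the label of \<open>a\<close> and \<open>b\<close> is not odd, their coefficients
  vanish and both act diagonally, so a character separates them. Pulled back along the retraction it
  must be constant along the odd labels through \<open>c\<close>. The value 2 only has to differ
  from 0 and 1.\<close>

lemma odd_label_trans:
  assumes cox: "coxeter_matrix M S" and ret: "parabolic_retractable M S"
    and S: "a \<in> S" "b \<in> S" "c \<in> S"
    and ac: "odd_label M a c" and cb: "odd_label M c b"
  shows "odd_label M a b"
proof (rule ccontr)
  assume ab: "\<not> odd_label M a b"
  then have ba: "\<not> odd_label M b a" using odd_label_sym[OF cox] S by blast
  have neq: "a \<noteq> b" "a \<noteq> c" "c \<noteq> b" using ab ac cb odd_label_refl[OF cox] S by auto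
  define n where "n s t = (if s = t then 1 else braid_coeff M 2 s t)" for s t
  have rep: "is_rep M S n"
  proof (rule is_repI[OF cox, where q = "\<lambda>_. 2"])
    fix s t assume "s \<in> S" "t \<in> S" "s \<noteq> t" "odd_label M s t"
    then show "2 = (2::complex) \<and> n s t = n t s \<and> (n s t)\<^sup>2 = braid_square 2 (M s t)"
      using odd_label_sym[OF cox] coxeter_matrix_sym[OF cox] by (auto simp: n_def braid_coeff_def)
  next
    fix s t k assume "s \<in> S" "t \<in> S" "s \<noteq> t" "M s t = enat (2 * k)"
    then show "word_act n (alt_word s t (2 * k)) = word_act n (alt_word t s (2 * k))"
      using coxeter_matrix_sym[OF cox, of s t]
      by (intro braid_commuting) (auto simp: n_def braid_coeff_def odd_label_def)
  qed (auto simp: n_def)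
  let ?U = "\<lambda>x. x a" and ?V = "\<lambda>x. x b"
  have "acts_tri ?U ?V (word_act n [(a, False)]) (2, 0, 1)"
    "acts_tri ?U ?V (word_act n [(b, False)]) (1, 0, 2)"
    using neq ab ba by (auto simp: acts_tri_def n_def braid_coeff_def)
  from retraction_tri[OF ret rep S(1,2) this, of "\<lambda>u. if u = a then 1 else 0" "\<lambda>u. if u = b then 1 else 0"]
  obtain P where P: "P a = (2, 0, 1)" "P b = (1, 0, 2)"
    "\<And>s. s \<in> S \<Longrightarrow> fst (P s) \<noteq> 0 \<and> snd (snd (P s)) \<noteq> 0"
    "\<And>s t m. s \<in> S \<Longrightarrow> t \<in> S \<Longrightarrow> s \<noteq> t \<Longrightarrow> M s t = enat m \<Longrightarrow>
       tri_alt (P s) (P t) m = tri_alt (P t) (P s) m"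
    using neq by auto
  have "fst (P s) = fst (P t)" if "s \<in> S" "t \<in> S" "s \<noteq> t" "odd_label M s t" for s t
    using that P(3,4) tri_alt_odd_eq_diag(1) unfolding odd_label_def by metis
  from this[of a c] this[of c b] show False using S neq ac cb P(1,2) by simp
qed

text \<open>At \<open>q = - \<zeta>\<close>, with \<zeta> of order \<open>p\<close>, the plane of
  \<open>a\<close> and \<open>b\<close> becomes reducible: the square of the mixed coefficient
  equals \<open>(q - 1)\<^sup>2\<close>. The image of \<open>c\<close> then has one free entry,
  which cannot match both \<open>a\<close> and \<open>b\<close>.\<close>

lemma odd_labels_dvd:
  assumes cox: "coxeter_matrix M S" and ret: "parabolic_retractable M S"
    and S: "a \<in> S" "b \<in> S" "c \<in> S" and neq: "a \<noteq> b" "a \<noteq> c" "c \<noteq> b"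
    and p: "M a b = enat p" "odd p" and l: "M c b = enat l" "odd l" and r: "M c a = enat r" "odd r"
  shows "p dvd l \<or> p dvd r"
proof -
  have p2: "p \<ge> 2" using coxeter_matrix_ge_2[OF cox S(1,2) neq(1) p(1)] .
  define \<zeta> where "\<zeta> = unity_root p"
  have \<zeta>: "\<zeta> ^ k = 1 \<longleftrightarrow> p dvd k" for k
    unfolding \<zeta>_def using p2 by (simp add: unity_root_power_eq_1_iff)
  have \<zeta>0: "\<zeta> \<noteq> 0" by (simp add: \<zeta>_def unity_root_def)
  have \<zeta>1: "\<zeta> \<noteq> - 1"
  proof
    assume "\<zeta> = - 1"
    then have "p dvd 2" using \<zeta>[of 2] by simp
    then show False using p2 p by (metis dvd_imp_le even_numeral le_antisym zero_less_numeral)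
  qed
  \<comment> \<open>On the pair \<open>{a, b}\<close> the root is prescribed as
    \<open>q - 1\<close>, since the principal root could have the opposite sign; with this sign
    \<open>x a - x b\<close> is invariant under both letters.\<close>
  define n where "n s t = (if s = t \<or> {s, t} = {a, b} then - \<zeta> - 1 else braid_coeff M (- \<zeta>) s t)" for s t
  have rep: "is_rep M S n"
  proof (rule is_repI[OF cox, where q = "\<lambda>_. - \<zeta>"])
    fix s t assume st: "s \<in> S" "t \<in> S" "s \<noteq> t" "odd_label M s t"
    show "- \<zeta> = - \<zeta> \<and> n s t = n t s \<and> (n s t)\<^sup>2 = braid_square (- \<zeta>) (M s t)"
    proof (cases "{s, t} = {a, b}")
      case True
      then have "M s t = enat p"
        using p coxeter_matrix_sym[OF cox S(1,2)] by (auto simp: doubleton_eq_iff)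
      moreover have "(- \<zeta> - 1)\<^sup>2 = - (- \<zeta>) * (\<zeta> + 2 + 1 / \<zeta>)"
        using \<zeta>0 by (simp add: field_simps power2_eq_square)
      moreover have "n s t = - \<zeta> - 1" "n t s = - \<zeta> - 1"
        using True by (auto simp: n_def insert_commute)
      ultimately show ?thesis by (simp add: braid_square_def \<zeta>_def[symmetric])
    next
      case False
      then show ?thesis
        using st odd_label_sym[OF cox] coxeter_matrix_sym[OF cox]
        by (auto simp: n_def braid_coeff_def insert_commute)
    qed
  next
    fix s t k assume st: "s \<in> S" "t \<in> S" "s \<noteq> t" "M s t = enat (2 * k)"
    moreover have "{s, t} \<noteq> {a, b}"
      using p st coxeter_matrix_sym[OF cox S(1,2)] by (auto simp: doubleton_eq_iff)
    ultimately show "word_act n (alt_word s t (2 * k)) = word_act n (alt_word t s (2 * k))"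
      using coxeter_matrix_sym[OF cox, of s t]
      by (intro braid_commuting) (auto simp: n_def braid_coeff_def odd_label_def insert_commute)
  qed (auto simp: n_def \<zeta>0)
  let ?U = "\<lambda>x. x a" and ?V = "\<lambda>x. x a - x b"
  have nab: "n a a = - \<zeta> - 1" "n b b = - \<zeta> - 1" "n a b = - \<zeta> - 1" "n b a = - \<zeta> - 1"
    by (auto simp: n_def)
  have "acts_tri ?U ?V (word_act n [(a, False)]) (- \<zeta>, 0, 1)"
    "acts_tri ?U ?V (word_act n [(b, False)]) (- \<zeta>, 1 + \<zeta>, 1)"
    using \<zeta>0 by (auto simp: acts_tri_def nab algebra_simps)
  from retraction_tri[OF ret rep S(1,2) this, of "\<lambda>_. 1" "\<lambda>u. if u = b then - 1 else 0"]
  obtain P where P: "P a = (- \<zeta>, 0, 1)" "P b = (- \<zeta>, 1 + \<zeta>, 1)"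
    "\<And>s. s \<in> S \<Longrightarrow> fst (P s) \<noteq> 0 \<and> snd (snd (P s)) \<noteq> 0"
    "\<And>s t m. s \<in> S \<Longrightarrow> t \<in> S \<Longrightarrow> s \<noteq> t \<Longrightarrow> M s t = enat m \<Longrightarrow>
       tri_alt (P s) (P t) m = tri_alt (P t) (P s) m"
    using neq by auto
  have ca: "tri_alt (P c) (P a) r = tri_alt (P a) (P c) r" and cb: "tri_alt (P c) (P b) l = tri_alt (P b) (P c) l"
    using P(4) S neq l r by blast+
  have "fst (P c) = fst (P a)" "snd (snd (P c)) = snd (snd (P a))"
    using tri_alt_odd_eq_diag[OF ca r(2)] P(3) S by blast+
  then obtain \<kappa> where c: "P c = (- \<zeta>, \<kappa>, 1)" by (cases "P c") (simp add: P(1))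
  \<comment> \<open>Here \<open>- \<rho>\<close> is \<zeta>, so a length not divisible by
    \<open>p\<close> forces \<kappa> to be the entry of \<open>a\<close> or of \<open>b\<close>.
    These differ because \<zeta> has odd order.\<close>
  have "\<kappa> = 0 \<or> p dvd r" "\<kappa> = 1 + \<zeta> \<or> p dvd l"
    using tri_alt_eq_unipotent_quotient[OF ca[unfolded c P(1)]]
      tri_alt_eq_unipotent_quotient[OF cb[unfolded c P(2)]] by (auto simp: \<zeta>)
  then show ?thesis using \<zeta>1 by (auto simp: add_eq_0_iff)
qed

text \<open>Otherwise some representation makes \<open>z\<close> and \<open>t\<close> satisfy their
  own relation but not the one of length \<open>a\<close>. The odd label forces \<open>y\<close> to
  have the same matrix as \<open>z\<close>, which contradicts the relation of \<open>y\<close> and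
  \<open>t\<close>.\<close>

lemma even_label_dvd:
  assumes cox: "coxeter_matrix M S" and ret: "parabolic_retractable M S"
    and S: "y \<in> S" "z \<in> S" "t \<in> S"
    and yz: "odd_label M y z" and yt: "M y t = enat a" "even a"
  shows "\<exists>b. M z t = enat b \<and> b dvd a"
proof (rule ccontr)
  assume neg: "\<not> ?thesis"
  have nyt: "\<not> odd_label M y t" using yt by (auto simp: odd_label_def)
  then have nzt: "\<not> odd_label M z t" using odd_label_trans[OF cox ret S(1,3,2) yz] by blast
  then have ntz: "\<not> odd_label M t z" using odd_label_sym[OF cox] S by blast
  have neq: "y \<noteq> t" "z \<noteq> t" "y \<noteq> z"
    using nyt nzt neg yt odd_label_refl[OF cox] S by auto
  have a2: "a \<ge> 2" using coxeter_matrix_ge_2[OF cox S(1,3) neq(1) yt(1)] .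
  \<comment> \<open>\<open>N\<close> never divides \<open>a div 2\<close>: a finite label
    \<open>2 * N\<close> does not divide \<open>a\<close>, and for an infinite label
    \<open>N = a\<close> exceeds its half.\<close>
  define N where "N = (case M z t of enat b \<Rightarrow> b div 2 | \<infinity> \<Rightarrow> a)"
  have fin: "b = 2 * N \<and> \<not> b dvd a" if "M z t = enat b" for b
    using that nzt neg by (auto simp: N_def odd_label_def)
  have N2: "N \<ge> 2"
  proof (cases "M z t")
    case (enat b)
    then have "b \<ge> 2" "b = 2 * N" "\<not> b dvd a"
      using coxeter_matrix_ge_2[OF cox S(2,3) neq(2)] fin by auto
    then have "N \<ge> 1" "N \<noteq> 1" using yt by auto
    then show ?thesis by simp
  qed (use a2 in \<open>simp add: N_def\<close>)
  define \<zeta> where "\<zeta> = unity_root N"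
  have \<zeta>: "\<zeta> ^ k = 1 \<longleftrightarrow> N dvd k" for k
    unfolding \<zeta>_def using N2 by (simp add: unity_root_power_eq_1_iff)
  have \<zeta>0: "\<zeta> \<noteq> 0" by (simp add: \<zeta>_def unity_root_def)
  have \<zeta>1: "\<zeta> \<noteq> 1" using \<zeta>[of 1] N2 by auto
  have norm: "norm \<zeta> = 1" by (simp add: \<zeta>_def unity_root_def)
  have \<zeta>2: "2 * \<zeta> \<noteq> 1"
  proof
    assume "2 * \<zeta> = 1"
    then have "norm (2 * \<zeta>) = 1" by simp
    then show False by (simp add: norm_mult norm)
  qed
  \<comment> \<open>Constant on odd classes, as odd relations demand. The \<open>N\<close>-th powers
    of 2 and \<open>2 * \<zeta>\<close> agree, which yields the relation of \<open>z\<close> and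
    \<open>t\<close> if there is one; modulus 2 keeps both values away from 1.\<close>
  define q where "q s = (if odd_label M t s then 2 * \<zeta> else 2)" for s
  \<comment> \<open>The one-sided coefficient between \<open>t\<close> and \<open>z\<close> keeps
    them from commuting, so that even relations detect the order of \<zeta>.\<close>
  define n where "n s u = (if s = u then q s - 1 else if s = t \<and> u = z then 1
    else if s = z \<and> u = t then 0 else braid_coeff M (q s) s u)" for s u
  have qz: "q z = 2" and qt: "q t = 2 * \<zeta>"
    using ntz odd_label_refl[OF cox S(3)] by (auto simp: q_def)
  have rep: "is_rep M S n"
  proof (rule is_repI[OF cox, where q = q])
    fix s u assume su: "s \<in> S" "u \<in> S" "s \<noteq> u" "odd_label M s u"
    have us: "odd_label M u s" using su odd_label_sym[OF cox] by blast
    have "odd_label M t s \<longleftrightarrow> odd_label M t u"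
      using odd_label_trans[OF cox ret S(3)] su us by blast
    then have "q s = q u" by (simp add: q_def)
    have "\<not> (s = t \<and> u = z)" "\<not> (s = z \<and> u = t)" using su nzt ntz by auto
    then have "n s u = braid_coeff M (q s) s u" "n u s = braid_coeff M (q u) u s"
      using su(3) unfolding n_def by metis+
    then have "n s u = csqrt (braid_square (q s) (M s u))" "n u s = csqrt (braid_square (q u) (M u s))"
      using su(4) us by (simp_all add: braid_coeff_def)
    then show "q s = q u \<and> n s u = n u s \<and> (n s u)\<^sup>2 = braid_square (q s) (M s u)"
      unfolding coxeter_matrix_sym[OF cox su(1,2)] \<open>q s = q u\<close> by simp
  next
    fix s u k assume su: "s \<in> S" "u \<in> S" "s \<noteq> u" "M s u = enat (2 * k)"
    have us: "M u s = enat (2 * k)" using su coxeter_matrix_sym[OF cox] by metis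
    have zt: "word_act n (alt_word z t (2 * k)) = word_act n (alt_word t z (2 * k))" if "M z t = enat (2 * k)"
    proof (rule braid_even[where q = 2 and p = "2 * \<zeta>"])
      have "k = N" using fin[OF that] by simp
      then show "2 ^ k = (2 * \<zeta>) ^ k" by (simp add: power_mult_distrib \<zeta>)
    qed (use neq \<zeta>0 \<zeta>1 \<zeta>2 in \<open>auto simp: n_def qz qt\<close>)
    show "word_act n (alt_word s u (2 * k)) = word_act n (alt_word u s (2 * k))"
    proof (cases "(s = t \<and> u = z) \<or> (s = z \<and> u = t)")
      case True
      then show ?thesis using zt su us by auto
    next
      case False
      then show ?thesis
        using su us by (intro braid_commuting) (auto simp: n_def braid_coeff_def odd_label_def)
    qed
  next
    fix s assume "s \<in> S"
    then show "n s s = q s - 1 \<and> q s \<noteq> 0" using \<zeta>0 by (auto simp: n_def q_def)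
  qed
  let ?U = "\<lambda>x. x z" and ?V = "\<lambda>x. x t"
  have "acts_tri ?U ?V (word_act n [(z, False)]) (2, 0, 1)"
    "acts_tri ?U ?V (word_act n [(t, False)]) (1, 1, 2 * \<zeta>)"
    using neq \<zeta>0 by (auto simp: acts_tri_def n_def qz qt algebra_simps)
  from retraction_tri[OF ret rep S(2,3) this, of "\<lambda>u. if u = z then 1 else 0" "\<lambda>u. if u = t then 1 else 0"]
  obtain P where P: "P z = (2, 0, 1)" "P t = (1, 1, 2 * \<zeta>)"
    "\<And>s. s \<in> S \<Longrightarrow> fst (P s) \<noteq> 0 \<and> snd (snd (P s)) \<noteq> 0"
    "\<And>s t m. s \<in> S \<Longrightarrow> t \<in> S \<Longrightarrow> s \<noteq> t \<Longrightarrow> M s t = enat m \<Longrightarrow>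
       tri_alt (P s) (P t) m = tri_alt (P t) (P s) m"
    using neq by auto
  obtain m where m: "M y z = enat m" "odd m" using yz by (auto simp: odd_label_def)
  have eq: "tri_alt (P y) (P z) m = tri_alt (P z) (P y) m"
    and eq': "tri_alt (P y) (P t) a = tri_alt (P t) (P y) a"
    using P(4) S neq m yt by blast+
  have "fst (P y) = fst (P z)" "snd (snd (P y)) = snd (snd (P z))"
    using tri_alt_odd_eq_diag[OF eq m(2)] P(3) S by blast+
  then obtain \<kappa> where y: "P y = (2, \<kappa>, 1)" by (cases "P y") (simp add: P(1))
  have "m > 0" using m(2) by (rule odd_pos)
  \<comment> \<open>As -2 is no root of unity, the odd relation pins down the off-diagonal entry and
    gives \<open>P y = P z\<close>.\<close>
  have "(- 2 :: complex) ^ m \<noteq> 1"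
  proof
    assume "(- 2 :: complex) ^ m = 1"
    then have "norm ((- 2 :: complex) ^ m) = 1" by simp
    then have "(2::real) ^ m = 1" by (simp add: norm_power)
    then show False using \<open>m > 0\<close> one_less_power[of "2::real" m] by simp
  qed
  then have "\<kappa> = 0" using tri_alt_eq_unipotent_quotient[OF eq[unfolded y P(1)]] by simp
  obtain k where k: "a = 2 * k" using yt(2) by blast
  \<comment> \<open>The off-diagonal entries are \<open>2 * \<sigma>\<close> and \<sigma>, so their
    equality forces \<sigma> = 0.\<close>
  have "(2::complex) ^ k = (2 * \<zeta>) ^ k"
    using tri_alt_even[of 2 "2 * \<zeta>" k] eq' unfolding y P(2) k \<open>\<kappa> = 0\<close> by auto
  then have "N dvd k" by (simp add: power_mult_distrib \<zeta>)
  show False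
  proof (cases "M z t")
    case (enat b)
    then show False using fin[of b] \<open>N dvd k\<close> k by auto
  next
    case infinity
    then have "a dvd k" using \<open>N dvd k\<close> by (simp add: N_def)
    then show False using a2 k by (auto dest: dvd_imp_le)
  qed
qed

section \<open>Eliminating generators\<close>

text \<open>\<open>None\<close> stands for the identity element.\<close>

definition compatible :: "('s \<Rightarrow> 's \<Rightarrow> enat) \<Rightarrow> nat \<Rightarrow> 's option \<Rightarrow> 's option \<Rightarrow> bool" where
  "compatible M m x y \<longleftrightarrow> x = y \<or> even m \<and> (x = None \<or> y = None) \<or>
     (\<exists>a b k. x = Some a \<and> y = Some b \<and> M a b = enat k \<and> k dvd m)"

text \<open>Combinatorial form of an ordinary retraction: every braid relation is respected for
  reasons visible in the labels, so such maps can be composed without touching the groups.\<close>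

definition collapse :: "('s \<Rightarrow> 's \<Rightarrow> enat) \<Rightarrow> 's set \<Rightarrow> 's set \<Rightarrow> ('s \<Rightarrow> 's option) \<Rightarrow> bool" where
  "collapse M S Z f \<longleftrightarrow> (\<forall>s\<in>S. f s = None \<or> f s \<in> Some ` Z) \<and> (\<forall>s\<in>Z. f s = Some s) \<and>
     (\<forall>s\<in>S. \<forall>t\<in>S. \<forall>m. s \<noteq> t \<longrightarrow> M s t = enat m \<longrightarrow> compatible M m (f s) (f t))"

lemma compatible_dvd: "compatible M k x y \<Longrightarrow> k dvd m \<Longrightarrow> compatible M m x y"
  unfolding compatible_def by (metis dvd_trans)

lemma collapse_range:
  assumes "collapse M S Z f" "s \<in> S" "f s = Some a"
  shows "a \<in> Z"
proof -
  have "f s = None \<or> f s \<in> Some ` Z" using assms(1,2) unfolding collapse_def by blast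
  then show ?thesis using assms(3) by auto
qed

lemma collapse_comp:
  assumes f: "collapse M S Z f" and g: "collapse M Z Y g" and "Y \<subseteq> Z"
  shows "collapse M S Y (\<lambda>s. Option.bind (f s) g)"
  unfolding collapse_def
proof (intro conjI ballI allI impI)
  fix s assume "s \<in> S"
  then show "Option.bind (f s) g = None \<or> Option.bind (f s) g \<in> Some ` Y"
    using collapse_range[OF f] g unfolding collapse_def by (cases "f s") auto
next
  fix s assume "s \<in> Y"
  then show "Option.bind (f s) g = Some s"
    using f g assms(3) unfolding collapse_def by auto
next
  fix s t m assume st: "s \<in> S" "t \<in> S" "s \<noteq> t" "M s t = enat m"
  have c: "compatible M m (f s) (f t)" using f st unfolding collapse_def by blast
  show "compatible M m (Option.bind (f s) g) (Option.bind (f t) g)"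
  proof (cases "f s = f t \<or> f s = None \<or> f t = None")
    case True
    then show ?thesis using c by (auto simp: compatible_def)
  next
    case False
    then obtain a b k where ab: "f s = Some a" "f t = Some b" "M a b = enat k" "k dvd m" "a \<noteq> b"
      using c by (auto simp: compatible_def)
    then have "a \<in> Z" "b \<in> Z" using collapse_range[OF f] st by blast+
    then have "compatible M k (g a) (g b)" using g ab unfolding collapse_def by blast
    then show ?thesis using ab by (auto intro: compatible_dvd)
  qed
qed

text \<open>Retractability is assumed for \<open>S\<close> only; the resulting facts about labels
  hold for all generators in \<open>S\<close> and so apply inside any \<open>Z\<close>.\<close>

lemma collapse_single:
  assumes cox: "coxeter_matrix M S" and ret: "parabolic_retractable M S"
    and Z: "Z \<subseteq> S" and y: "y \<in> Z"
  shows "\<exists>g. collapse M Z (Z - {y}) g"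
proof -
  define C where "C = {c \<in> Z - {y}. odd_label M y c}"
  obtain w where w: "w = None \<or> w \<in> Some ` (Z - {y})"
    and c: "\<And>t m. t \<in> Z \<Longrightarrow> t \<noteq> y \<Longrightarrow> M y t = enat m \<Longrightarrow> compatible M m w (Some t)"
  proof (cases "C = {}")
    case True
    have "compatible M m None (Some t)" if "t \<in> Z" "t \<noteq> y" "M y t = enat m" for t m
      using True that by (auto simp: C_def odd_label_def compatible_def)
    then show thesis using that[of None] by blast
  next
    case False
    then obtain z where z: "z \<in> C" and min: "\<And>t. t \<in> C \<Longrightarrow> the_enat (M y z) \<le> the_enat (M y t)"
      using ex_has_least_nat[of "\<lambda>c. c \<in> C" _ "\<lambda>c. the_enat (M y c)"] by blast
    have zS: "z \<in> Z" "z \<noteq> y" "odd_label M y z" "z \<in> S" "y \<in> S" using z y Z by (auto simp: C_def)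
    then obtain k where k: "M y z = enat k" "odd k" by (auto simp: odd_label_def)
    have "compatible M m (Some z) (Some t)" if t: "t \<in> Z" "t \<noteq> y" "M y t = enat m" for t m
    proof (cases "t = z")
      case False
      have tS: "t \<in> S" using t Z by blast
      show ?thesis
      proof (cases "even m")
        case True
        then show ?thesis
          using even_label_dvd[OF cox ret zS(5,4) tS zS(3) t(3)] by (auto simp: compatible_def)
      next
        case odd: False
        then have "t \<in> C" using t by (auto simp: C_def odd_label_def)
        then have km: "k \<le> m" using min[of t] k t by simp
        have "odd_label M z y" "odd_label M y t"
          using zS odd t odd_label_sym[OF cox] by (auto simp: odd_label_def)
        then have "odd_label M z t" using odd_label_trans[OF cox ret zS(4) tS zS(5)] by blast
        then obtain l where l: "M z t = enat l" "odd l" by (auto simp: odd_label_def)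
        have sym: "M z y = enat k" "M t y = enat m" "M t z = enat l"
          using k t l coxeter_matrix_sym[OF cox] zS tS by metis+
        have pos: "k > 0" "m > 0" using k odd by (auto intro: odd_pos)
        have "l dvd m \<or> l dvd k"
          using odd_labels_dvd[OF cox ret zS(4) tS zS(5) _ _ _ l t(3) odd k(1) k(2)] False zS t by auto
        moreover have "k dvd l \<or> k dvd m"
          using odd_labels_dvd[OF cox ret zS(5,4) tS _ _ _ k sym(3) l(2) sym(2) odd] False zS t by auto
        moreover have "m dvd l \<or> m dvd k"
          using odd_labels_dvd[OF cox ret zS(5) tS zS(4) _ _ _ t(3) odd l sym(1) k(2)] False zS t by auto
        \<comment> \<open>Each of the three labels divides another, so two coincide and the third
          divides them. As \<open>k \<le> m\<close>, the label \<open>m\<close> is among the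
          largest.\<close>
        ultimately have "l dvd m"
          using km pos by (metis dvd_antisym dvd_imp_le dvd_refl dvd_trans le_antisym)
        then show ?thesis using l by (auto simp: compatible_def)
      qed
    qed (simp add: compatible_def)
    then show thesis using that[of "Some z"] zS by blast
  qed
  \<comment> \<open>\<open>compatible\<close> reads labels in a fixed order, so exchanging its
    arguments uses the symmetry of \<open>M\<close>.\<close>
  have c': "compatible M m (Some t) w" if "t \<in> Z" "t \<noteq> y" "M t y = enat m" for t m
  proof -
    have "M y t = enat m" using that Z y coxeter_matrix_sym[OF cox, of y t] by auto
    then have "compatible M m w (Some t)" using c that by blast
    moreover have "M a t = M t a" if "a \<in> Z - {y}" for a
      using that \<open>t \<in> Z\<close> Z coxeter_matrix_sym[OF cox, of a t] by auto
    ultimately show ?thesis using w unfolding compatible_def by fastforce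
  qed
  have "collapse M Z (Z - {y}) (\<lambda>s. if s = y then w else Some s)"
    unfolding collapse_def
  proof (intro conjI ballI allI impI)
    fix s t m assume "s \<in> Z" "t \<in> Z" "s \<noteq> t" "M s t = enat m"
    then show "compatible M m (if s = y then w else Some s) (if t = y then w else Some t)"
      using c[of t m] c'[of s m] by (auto simp: compatible_def)
  qed (use w in auto)
  then show ?thesis by blast
qed

lemma collapse_exists:
  assumes cox: "coxeter_matrix M S" and ret: "parabolic_retractable M S" and "R \<subseteq> S"
  shows "\<exists>f. collapse M S (S - R) f"
proof -
  have "finite R" using assms finite_subset unfolding coxeter_matrix_def by blast
  then show ?thesis using assms(3)
  proof (induction R)
    case empty
    have "collapse M S S Some" by (auto simp: collapse_def compatible_def)
    then show ?case by auto
  next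
    case (insert y R)
    then obtain f where f: "collapse M S (S - R) f" by auto
    obtain g where "collapse M (S - R) (S - R - {y}) g"
      using collapse_single[OF cox ret, of "S - R" y] insert by auto
    from collapse_comp[OF f this] show ?case
      by (metis Diff_insert Diff_subset)
  qed
qed

section \<open>Braid relations after substitution\<close>

lemma alt_word_add:
  "alt_word a b (m + k) = alt_word a b m @ (if even m then alt_word a b k else alt_word b a k)"
  by (induction m arbitrary: a b) auto

text \<open>The alternating word splits into blocks of length \<open>k\<close>, each exchanged by
  the given relation. For odd \<open>k\<close> successive blocks start with different letters, hence
  the use of the reversed relation.\<close>

lemma artin_eq_alt_word_dvd:
  assumes ab: "a \<in> S" "b \<in> S" "a \<noteq> b" "M a b = enat k" and "k dvd m"
  shows "artin_eq M S (alt_word a b m) (alt_word b a m)"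
proof -
  obtain j where "m = k * j" using assms(5) by blast
  moreover have "artin_eq M S (alt_word a b (k * j)) (alt_word b a (k * j))"
  proof (induction j)
    case 0
    then show ?case by (simp add: artin_eq.refl)
  next
    case (Suc j)
    have "artin_eq M S ([] @ alt_word a b k @ []) ([] @ alt_word b a k @ [])"
      using ab by (intro artin_eq.braid) auto
    then have "artin_eq M S (alt_word a b k) (alt_word b a k)" by simp
    then show ?case
      using Suc artin_eq.sym[OF Suc] by (simp add: alt_word_add artin_eq_append)
  qed
  ultimately show ?thesis by simp
qed

lemma word_subst_alt_word_same:
  "W s = W t \<Longrightarrow> word_subst W (alt_word s t m) = word_subst W (alt_word t s m)"
  by (induction m arbitrary: s t) auto

lemma word_subst_alt_word_Nil:
  "W s = [] \<Longrightarrow> word_subst W (alt_word s t (2 * k)) = word_subst W (alt_word t s (2 * k))"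
  by (induction k) auto

lemma word_subst_alt_word_letters:
  "W s = [(a, False)] \<Longrightarrow> W t = [(b, False)] \<Longrightarrow> word_subst W (alt_word s t m) = alt_word a b m"
  by (induction m arbitrary: s t a b) auto

theorem theorem1p3:
  fixes M :: "'s \<Rightarrow> 's \<Rightarrow> enat" and S Y :: "'s set"
  assumes "coxeter_matrix M S"
    and "parabolic_retractable M S"
    and "Y \<subseteq> S"
  shows "\<exists>\<phi>. ordinary_retraction M S Y \<phi>"
proof -
  have "S - (S - Y) = Y" using assms(3) by blast
  then obtain f where f: "collapse M S Y f"
    using collapse_exists[OF assms(1,2), of "S - Y"] by auto
  define W where "W s = (case f s of None \<Rightarrow> [] | Some z \<Rightarrow> [(z, False)])" for s
  have image: "W s = [] \<or> (\<exists>z\<in>Y. W s = [(z, False)])" if "s \<in> S" for s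
    using f that by (auto simp: collapse_def W_def)
  then have over: "\<forall>s\<in>S. W s \<in> words_over Y" by fastforce
  show ?thesis
  proof (rule ordinary_retraction_of_subst[OF assms(3) over])
    show "\<forall>s\<in>Y. W s = [(s, False)]" using f by (auto simp: collapse_def W_def)
    show "\<forall>s\<in>S. W s = [] \<or> (\<exists>z\<in>Y. W s = [(z, False)])" using image by blast
    fix u v assume "artin_eq M S u v"
    then show "artin_eq M S (word_subst W u) (word_subst W v)"
    proof (rule artin_eq_word_subst)
      show W: "\<forall>s\<in>S. W s \<in> words_over S" using over words_over_mono[OF _ assms(3)] by blast
      fix s t m assume st: "s \<in> S" "t \<in> S" "s \<noteq> t" "M s t = enat m"
      have refl: "artin_eq M S (word_subst W (alt_word s t m)) (word_subst W (alt_word t s m))"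
        if "word_subst W (alt_word s t m) = word_subst W (alt_word t s m)"
        unfolding that using st W by (intro artin_eq.refl word_subst_in_words_over[of S]) auto
      have "compatible M m (f s) (f t)" using f st unfolding collapse_def by blast
      \<comment> \<open>Equal images belong to the first case, so the last one may assume
        \<open>a \<noteq> b\<close>, as the braid relation requires.\<close>
      then consider "f s = f t" | "even m" "f s = None" | "even m" "f t = None"
        | a b k where "f s = Some a" "f t = Some b" "M a b = enat k" "k dvd m" "a \<noteq> b"
        unfolding compatible_def by metis
      then show "artin_eq M S (word_subst W (alt_word s t m)) (word_subst W (alt_word t s m))"
      proof cases
        case 1
        then show ?thesis by (intro refl word_subst_alt_word_same) (simp add: W_def)
      next
        case 2
        then show ?thesis
          using word_subst_alt_word_Nil[of W s t "m div 2"] by (intro refl) (simp add: W_def)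
      next
        case 3
        then show ?thesis
          using word_subst_alt_word_Nil[of W t s "m div 2"] by (intro refl) (simp add: W_def)
      next
        case 4
        then have "a \<in> S" "b \<in> S" using collapse_range[OF f] st assms(3) by blast+
        moreover have "word_subst W (alt_word s t m) = alt_word a b m"
          "word_subst W (alt_word t s m) = alt_word b a m"
          using 4 by (simp_all add: W_def word_subst_alt_word_letters)
        ultimately show ?thesis using 4 artin_eq_alt_word_dvd[of a S b M k m] by simp
      qed
    qed
  qed
qed

end
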